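(* Let $f\in\mathcal{H}^1$. The momentum map $J^f:\mathcal{O}\times\mathcal{H}^{1,+}_0\to\mathcal{H}^{1,+}_0$, which assigns to $(w,p)$ the element of $\mathcal{H}^{1,+}_0$ whose $k$-th Fourier coefficient is $J^f_k(w,p)$ for every $k\ge1$, is (well defined and) analytic.
   Context: All spaces are complex, and "analytic" means complex-analytic between (open subsets of) complex Banach spaces. $\mathbb{T}=\mathbb{R}/\mathbb{Z}$, $f_k=(f)_k=\int_0^1 f(y)e^{-2\pi i k y}\,dy$ are Fourier coefficients, $\langle k\rangle:=|k|$ for $k\neq0$, $\langle0\rangle:=1$. $\mathcal{H}^1$ is the Hilbert space of functions $f:\mathbb{T}\to\mathbb{C}$ with $\|f\|_{\mathcal{H}^1}=(\sum_{k\in\mathbb{Z}}|f_k|^2\langle k\rangle^2)^{1/2}<\infty$ (a Banach algebra under pointwise multiplication). $\mathcal{H}^{1,+}=\{f\in\mathcal{H}^1: f_k=0 \text{ for } k<0\}$, $\mathcal{H}^{1,+}_0=\{f\in\mathcal{H}^1: f_k=0\text{ for }k\le 0\}$, and $\Pi^+,\Pi^+_0$ are the corresponding Fourier-truncation projections of $\mathcal{H}^1$. The bilinear pairing is $\langle f,g\rangle=\sum_{k\in\mathbb{Z}}f_kg_k$, and $\check f(y):=f(-y)$. $\mathcal{O}:=\{w\in\mathcal{H}^{1,+}_0: w(y)\ne0\ \forall y\in\mathbb{T}\}$, open and dense in $\mathcal{H}^{1,+}_0$; $1/w\in\mathcal{H}^1$ for $w\in\mathcal{O}$. Shift: $(Lf)(y)=f(y)e^{-2\pi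 i y}$. For $w\in\mathcal{H}^{1,+}_0$, $k\ge1$: $A_k(w)g=g\,\Pi^+(L^{k+1}w)-w\,\Pi^+(L^{k+1}g)$, $g\in\mathcal{H}^{1,+}_0$; $\Gamma(w)p=\Pi^+_0(w\check p)$; $I_k(w,p)=\langle A_k(w)\Gamma(w)p,p\rangle$; $U^f_k(w)=-\big(w\,\Pi^+_0(f/w)\big)_{k+1}$ for $w\in\mathcal{O}$; $J^f_k(w,p)=I_k(w,p)+U^f_k(w)$. *)

theory Defs
  imports "HOL-Analysis.Analysis"
begin

section \<open>Complex Banach spaces and analytic maps\<close>

class complex_normed_vector = real_normed_vector +
  fixes scaleC :: "complex \<Rightarrow> 'a \<Rightarrow> 'a"  (infixr "*\<^sub>C" 75)
  assumes scaleC_add_right: "a *\<^sub>C (x + y) = a *\<^sub>C x + a *\<^sub>C y"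
    and scaleC_add_left: "(a + b) *\<^sub>C x = a *\<^sub>C x + b *\<^sub>C x"
    and scaleC_scaleC: "a *\<^sub>C b *\<^sub>C x = (a * b) *\<^sub>C x"
    and scaleC_of_real: "complex_of_real r *\<^sub>C x = r *\<^sub>R x"
    and norm_scaleC: "norm (a *\<^sub>C x) = cmod a * norm x"

class complex_banach = complex_normed_vector + complete_space

instantiation prod :: (complex_normed_vector, complex_normed_vector) complex_normed_vector
begin

definition "c *\<^sub>C z = (c *\<^sub>C fst z, c *\<^sub>C snd z)"

instance
proof
  fix a b :: complex and r :: real and x y :: "'a \<times> 'b"
  show "norm (a *\<^sub>C x) = cmod a * norm x"
    by (simp add: scaleC_prod_def norm_prod_def norm_scaleC power_mult_distrib real_sqrt_mult
        flip: distrib_left)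
qed (simp_all add: scaleC_prod_def prod_eq_iff scaleC_add_right scaleC_add_left scaleC_scaleC
       scaleC_of_real)

end

instance prod :: (complex_banach, complex_banach) complex_banach ..

text \<open>A bounded \<open>n\<close>-linear map is encoded as a function of lists, constrained only on lists of
  length \<open>n\<close>; for \<open>n = 0\<close> it is a constant.\<close>

definition bounded_multilinear ::
  "nat \<Rightarrow> ('a::complex_normed_vector list \<Rightarrow> 'b::complex_normed_vector) \<Rightarrow> bool" where
  "bounded_multilinear n A \<longleftrightarrow>
     (\<forall>xs i x y. length xs = n \<longrightarrow> i < n \<longrightarrow> A (xs[i := x + y]) = A (xs[i := x]) + A (xs[i := y])) \<and>
     (\<forall>xs i c x. length xs = n \<longrightarrow> i < n \<longrightarrow> A (xs[i := c *\<^sub>C x]) = c *\<^sub>C A (xs[i := x])) \<and>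
     (\<exists>K. \<forall>xs. length xs = n \<longrightarrow> norm (A xs) \<le> K * (\<Prod>x\<leftarrow>xs. norm x))"

text \<open>Local expansion into a uniformly convergent series of continuous \<open>n\<close>-homogeneous complex
  polynomials \<open>h \<mapsto> A\<^sub>n(h, \<dots>, h)\<close>.\<close>

definition complex_analytic_on :: "('a::complex_banach \<Rightarrow> 'b::complex_banach) \<Rightarrow> 'a set \<Rightarrow> bool" where
  "complex_analytic_on F U \<longleftrightarrow> open U \<and>
     (\<forall>x\<in>U. \<exists>r>0. \<exists>A. (\<forall>n. bounded_multilinear n (A n)) \<and>
        uniform_limit (ball 0 r) (\<lambda>N h. \<Sum>n<N. A n (replicate n h)) (\<lambda>h. F (x + h)) sequentially)"

section \<open>The space \<open>H\<^sup>1\<close>\<close>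

text \<open>Functions on the torus are 1-periodic functions on the reals.\<close>

definition fourier_coeff :: "(real \<Rightarrow> complex) \<Rightarrow> int \<Rightarrow> complex" where
  "fourier_coeff f k = integral {0..1} (\<lambda>y. f y * cis (- 2 * pi * of_int k * y))"

definition bracket :: "int \<Rightarrow> real" where
  "bracket k = (if k = 0 then 1 else real_of_int \<bar>k\<bar>)"

text \<open>Elements of \<open>H\<^sup>1\<close> are represented by their (unique) continuous representatives, so that
  pointwise values are meaningful.\<close>

definition H1 :: "(real \<Rightarrow> complex) set" where
  "H1 = {f. continuous_on UNIV f \<and> (\<forall>y. f (y + 1) = f y) \<and>
            (\<lambda>k. (cmod (fourier_coeff f k))\<^sup>2 * (bracket k)\<^sup>2) summable_on UNIV}"

definition norm_H1 :: "(real \<Rightarrow> complex) \<Rightarrow> real" where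
  "norm_H1 f = sqrt (\<Sum>\<^sub>\<infinity>k. (cmod (fourier_coeff f k))\<^sup>2 * (bracket k)\<^sup>2)"

subsection \<open>Fourier uniqueness and synthesis\<close>

lemma continuous_cis [continuous_intros]:
  "continuous_on A f \<Longrightarrow> continuous_on A (\<lambda>x. cis (f x :: real))"
  unfolding cis_conv_exp by (intro continuous_intros)

lemma fc_integrable:
  assumes "continuous_on UNIV f"
  shows "(\<lambda>y. f y * cis (c * y)) integrable_on {0..1::real}"
  by (intro integrable_continuous_interval continuous_intros)
     (use assms continuous_on_subset in blast)

lemma fc_add:
  assumes "continuous_on UNIV f" "continuous_on UNIV g"
  shows "fourier_coeff (\<lambda>y. f y + g y) k = fourier_coeff f k + fourier_coeff g k"
  unfolding fourier_coeff_def distrib_right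
  by (intro integral_add fc_integrable assms)

lemma fc_scale: "fourier_coeff (\<lambda>y. c * f y) k = c * fourier_coeff f k"
  unfolding fourier_coeff_def mult.assoc by (rule integral_mult_right)

lemma fc_zero [simp]: "fourier_coeff (\<lambda>y. 0) k = 0"
  by (simp add: fourier_coeff_def)

lemma fc_cis_mult: "fourier_coeff (\<lambda>y. f y * cis (2 * pi * of_int j * y)) k = fourier_coeff f (k - j)"
  unfolding fourier_coeff_def
  by (intro arg_cong[where f="integral _"] ext)
     (simp add: mult.assoc cis_mult algebra_simps)

lemma fc_cis: "fourier_coeff (\<lambda>y. cis (2 * pi * of_int j * y)) k = (if j = k then 1 else 0)"
proof -
  define m where "m = j - k"
  have eq: "fourier_coeff (\<lambda>y. cis (2 * pi * of_int j * y)) k = integral {0..1} (\<lambda>y. cis (2 * pi * of_int m * y))"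
    unfolding fourier_coeff_def m_def
    by (intro arg_cong[where f="integral _"] ext) (simp add: cis_mult algebra_simps)
  show ?thesis
  proof (cases "m = 0")
    case True thus ?thesis unfolding eq by (simp add: m_def)
  next
    case False
    define c where "c = 2 * pi * \<i> * of_int m"
    have c: "c \<noteq> 0" using False by (simp add: c_def)
    have e: "cis (2 * pi * of_int m * y) = exp (c * of_real y)" for y
      by (simp add: cis_conv_exp c_def algebra_simps)
    have "((\<lambda>y. exp (c * of_real y)) has_integral (exp (c * of_real 1) / c - exp (c * of_real 0) / c)) {0..1}"
    proof (rule fundamental_theorem_of_calculus)
      fix x :: real assume "x \<in> {0..1}"
      show "((\<lambda>x. exp (c * of_real x) / c) has_vector_derivative exp (c * of_real x)) (at x within {0..1})"
        using c by (auto intro!: derivative_eq_intros has_vector_derivative_real_field)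
    qed simp
    moreover have "exp c = 1" unfolding c_def exp_eq_1 by auto
    ultimately show ?thesis unfolding eq e using False m_def
      by (simp add: integral_unique)
  qed
qed

definition annih :: "(real \<Rightarrow> complex) \<Rightarrow> bool" where
  "annih h \<longleftrightarrow> continuous_on UNIV h \<and> (\<forall>g. continuous_on UNIV g \<longrightarrow>
     (\<forall>k. fourier_coeff g k = 0) \<longrightarrow> (\<forall>k. fourier_coeff (\<lambda>y. g y * h y) k = 0))"

lemma annih_mult: "annih h1 \<Longrightarrow> annih h2 \<Longrightarrow> annih (\<lambda>y. h1 y * h2 y)"
  unfolding annih_def mult.assoc[symmetric] by (auto intro!: continuous_intros)

lemma annih_add: "annih h1 \<Longrightarrow> annih h2 \<Longrightarrow> annih (\<lambda>y. h1 y + h2 y)"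
  unfolding annih_def distrib_left by (auto simp: fc_add continuous_on_mult intro!: continuous_on_add)

lemma annih_cis: "annih (\<lambda>y. cis (2 * pi * of_int j * y))"
  unfolding annih_def fc_cis_mult by (auto intro!: continuous_intros)

lemma annih_const: "annih (\<lambda>y. c)"
  unfolding annih_def mult.commute[of _ c] by (auto simp: fc_scale)

lemma annih_poly:
  assumes "real_polynomial_function p"
  shows "annih (\<lambda>y. complex_of_real (p (cis (2 * pi * y))))"
  using assms
proof induction
  case (linear p)
  interpret bounded_linear p by fact
  have "p z = Re z * p 1 + Im z * p \<i>" for z
  proof -
    have "z = Re z *\<^sub>R 1 + Im z *\<^sub>R \<i>" by (simp add: complex_eq_iff)
    thus ?thesis by (metis add scaleR real_scaleR_def)
  qed
  from this[of "cis (2 * pi * y)" for y] have eq: "complex_of_real (p (cis (2 * pi * y))) =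
     complex_of_real (p 1) * of_real (cos (2 * pi * y)) + complex_of_real (p \<i>) * of_real (sin (2 * pi * y))" for y
    by (simp only: cis.sel of_real_add of_real_mult mult.commute)
  have c: "complex_of_real (cos (2 * pi * y)) =
      (1 / 2) * (cis (2 * pi * of_int 1 * y) + cis (2 * pi * of_int (-1) * y))" for y
    by (simp add: complex_eq_iff)
  have s: "complex_of_real (sin (2 * pi * y)) =
      (- \<i> / 2) * (cis (2 * pi * of_int 1 * y) + (-1) * cis (2 * pi * of_int (-1) * y))" for y
    by (simp add: complex_eq_iff)
  show ?case unfolding eq c s by (intro annih_add annih_mult annih_const annih_cis)
qed (auto intro: annih_add annih_mult annih_const)

lemma periodic_int:
  assumes "\<And>y. f (y + 1) = f (y :: real)"
  shows "f (y + of_int n) = f y"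
proof (induction n rule: int_induct[where k=0])
  case (step1 i) thus ?case using assms[of "y + of_int i"] by (simp add: algebra_simps)
next
  case (step2 i) thus ?case using assms[of "y + of_int i - 1"] by (simp add: algebra_simps)
qed simp

lemma periodic_cis:
  assumes "\<And>y. f (y + 1) = f (y :: real)" "cis (2 * pi * x) = cis (2 * pi * y)"
  shows "f x = f y"
proof -
  have "cos (2 * pi * x) = cos (2 * pi * y) \<and> sin (2 * pi * x) = sin (2 * pi * y)"
    using assms(2) by (simp add: complex_eq_iff)
  then obtain n :: int where "2 * pi * x = 2 * pi * y + 2 * pi * of_int n"
    using sin_cos_eq_iff by (metis mult.assoc)
  hence "x = y + of_int n" by (metis distrib_left mult_cancel_left pi_neq_zero mult_eq_0_iff zero_neq_numeral)
  thus ?thesis using periodic_int[of f, OF assms(1)] by simp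
qed

lemma periodic_lift:
  fixes f :: "real \<Rightarrow> complex"
  assumes cont: "continuous_on UNIV f" and per: "\<And>y. f (y + 1) = f y"
  obtains F where "continuous_on (sphere 0 1) F" "\<And>y. F (cis (2 * pi * y)) = f y"
proof
  let ?F = "\<lambda>z. f (Arg2pi z / (2 * pi))"
  have f: "isCont f x" for x using cont by (simp add: continuous_on_eq_continuous_at)
  have c1: "cis (Arg2pi z) = z" if "cmod z = 1" for z
    using Arg2pi_eq[of z] that by (simp add: cis_conv_exp)
  have c2: "cis (Arg z) = z" if "cmod z = 1" for z
    using that by (metis cis_Arg norm_zero sgn_eq div_by_1 of_real_1 zero_neq_one)
  show "?F (cis (2 * pi * y)) = f y" for y
    by (rule periodic_cis[of f, OF per]) (simp add: c1)
  have eq: "?F z = f (Arg z / (2 * pi))" if "cmod z = 1" for z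
    by (rule periodic_cis[of f, OF per]) (simp add: c1 c2 that)
  show "continuous_on (sphere 0 1) ?F"
    unfolding continuous_on_eq_continuous_within
  proof
    fix z :: complex assume z: "z \<in> sphere 0 1"
    show "continuous (at z within sphere 0 1) ?F"
    proof (cases "z \<in> \<real>\<^sub>\<ge>\<^sub>0")
      case False
      have "isCont (\<lambda>z. Arg2pi z / (2 * pi)) z"
        by (intro continuous_intros continuous_at_Arg2pi False) simp
      from isCont_o2[OF this f] show ?thesis by (rule continuous_at_imp_continuous_within)
    next
      case True
      hence nz: "z \<notin> \<real>\<^sub>\<le>\<^sub>0" using z
        by (auto simp: complex_nonneg_Reals_iff complex_nonpos_Reals_iff cmod_eq_Re)
      have "isCont (\<lambda>z. Arg z / (2 * pi)) z"
        by (intro continuous_intros continuous_at_Arg nz) simp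
      from isCont_o2[OF this f] have "continuous (at z within sphere 0 1) (\<lambda>z. f (Arg z / (2 * pi)))"
        by (rule continuous_at_imp_continuous_within)
      thus ?thesis
        by (rule continuous_transform_within[OF _ zero_less_one]) (use z eq in \<open>auto simp: dist_norm\<close>)
    qed
  qed
qed

lemma fc_unique_zero:
  assumes cont: "continuous_on UNIV f" and per: "\<And>y. f (y + 1) = f y"
    and z: "\<And>k. fourier_coeff f k = 0"
  shows "f y = 0"
proof -
  obtain F where F: "continuous_on (sphere 0 1) F" "\<And>y. F (cis (2 * pi * y)) = f y"
    using periodic_lift[OF cont per] by metis
  have contI: "continuous_on {0..1} f" using cont continuous_on_subset by blast
  obtain M where M: "\<And>y. y \<in> {0..1} \<Longrightarrow> cmod (f y) \<le> M"
    using compact_continuous_image[OF contI] compact_imp_bounded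
    by (metis bounded_iff compact_Icc imageI)
  have M0: "M \<ge> 0" using M[of 0] norm_ge_zero[of "f 0"] by (simp del: norm_ge_zero)
  let ?I = "integral {0..1} (\<lambda>y. f y * cnj (f y))"
  have small: "cmod ?I \<le> M * e" if e: "e > 0" for e
  proof -
    have "continuous_on (sphere 0 1) (\<lambda>z. cnj (F z))" by (intro continuous_intros F)
    then obtain G where G: "polynomial_function G" "\<And>z. z \<in> sphere 0 1 \<Longrightarrow> cmod (cnj (F z) - G z) < e"
      using Stone_Weierstrass_polynomial_function[of "sphere 0 (1::real)" "\<lambda>z. cnj (F z)" e] e by auto
    define h where "h y = G (cis (2 * pi * y))" for y
    have "real_polynomial_function (Re \<circ> G)" "real_polynomial_function (Im \<circ> G)"
      using G(1) bounded_linear_Re bounded_linear_Im unfolding polynomial_function_def by auto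
    hence "annih (\<lambda>y. of_real (Re (h y)) + \<i> * of_real (Im (h y)))"
      unfolding h_def by (intro annih_add annih_mult annih_const) (auto dest: annih_poly)
    hence h: "annih h" by (simp flip: complex_eq)
    hence "fourier_coeff (\<lambda>y. f y * h y) 0 = 0" using cont z unfolding annih_def by blast
    hence h0: "integral {0..1} (\<lambda>y. f y * h y) = 0" by (simp add: fourier_coeff_def)
    have hc: "continuous_on {0..1} h" using h continuous_on_subset unfolding annih_def by blast
    have "?I = integral {0..1} (\<lambda>y. f y * cnj (f y)) - integral {0..1} (\<lambda>y. f y * h y)"
      using h0 by simp
    also have "\<dots> = integral {0..1} (\<lambda>y. f y * cnj (f y) - f y * h y)"
      by (rule integral_diff[symmetric]; intro integrable_continuous_interval continuous_intros contI hc)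
    finally have eq: "?I = integral {0..1} (\<lambda>y. f y * (cnj (f y) - h y))" by (simp add: right_diff_distrib)
    have "cmod (integral {0..1} (\<lambda>y. f y * (cnj (f y) - h y))) \<le> M * e * (1 - 0)"
    proof (rule integral_bound)
      show "continuous_on {0..1} (\<lambda>y. f y * (cnj (f y) - h y))" by (intro continuous_intros contI hc)
      fix t :: real assume t: "t \<in> {0..1}"
      have "cmod (cnj (f t) - h t) < e" using G(2)[of "cis (2 * pi * t)"] by (simp add: F h_def)
      thus "cmod (f t * (cnj (f t) - h t)) \<le> M * e"
        unfolding norm_mult using M[OF t] M0 by (intro mult_mono) auto
    qed simp
    thus ?thesis using eq by simp
  qed
  have "cmod ?I \<le> 0"
  proof (rule field_le_epsilon)
    fix e :: real assume "e > 0"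
    have "cmod ?I \<le> M * (e / (M + 1))" using \<open>e > 0\<close> M0 by (intro small) auto
    also have "\<dots> \<le> e" using \<open>e > 0\<close> M0 by (simp add: field_simps)
    finally show "cmod ?I \<le> 0 + e" by simp
  qed
  hence "?I = 0" by simp
  moreover have "?I = of_real (integral {0..1} (\<lambda>y. (cmod (f y))\<^sup>2))"
    using integral_linear[OF _ bounded_linear_of_real[where 'a=complex], of "\<lambda>y. (cmod (f y))\<^sup>2" "{0..1}"]
    by (simp add: complex_norm_square[symmetric] o_def
        integrable_continuous_interval continuous_intros contI)
  ultimately have "integral {0..1} (\<lambda>y. (cmod (f y))\<^sup>2) = 0" by simp
  hence "\<forall>x\<in>{0..1}. (cmod (f x))\<^sup>2 = 0"
    by (subst (asm) integral_eq_0_iff) (auto intro!: continuous_intros contI)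
  hence "f (frac y) = 0" using frac_lt_1[of y] by (auto simp: less_imp_le)
  moreover have "f (frac y + of_int \<lfloor>y\<rfloor>) = f (frac y)" by (rule periodic_int[of f, OF per])
  ultimately show ?thesis by (simp add: frac_def)
qed

lemma fc_synthesis:
  assumes "(\<lambda>k. cmod (a k)) summable_on UNIV"
  defines "g \<equiv> (\<lambda>y. \<Sum>\<^sub>\<infinity>k::int. a k * cis (2 * pi * of_int k * y))"
  shows "continuous_on UNIV g" "g (y + 1) = g y" "fourier_coeff g k = a k"
proof -
  have unif: "uniform_limit UNIV (\<lambda>X y. \<Sum>k\<in>X. a k * cis (2 * pi * of_int k * y)) g (finite_subsets_at_top UNIV)"
    unfolding g_def by (rule Weierstrass_m_test_general[OF _ assms(1)]) (simp add: norm_mult)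
  show cont: "continuous_on UNIV g"
    by (rule uniform_limit_theorem[OF _ unif]) (auto intro!: always_eventually continuous_intros)
  show "g (y + 1) = g y" unfolding g_def
    by (intro arg_cong2[where f=infsum] ext refl)
       (simp add: distrib_left cis_mult[symmetric] cis_multiple_2pi)
  have lim: "((\<lambda>X. fourier_coeff (\<lambda>y. \<Sum>j\<in>X. a j * cis (2 * pi * of_int j * y)) k) \<longlongrightarrow> fourier_coeff g k) (finite_subsets_at_top UNIV)"
  proof -
    have "uniform_limit {0..1} (\<lambda>X y. (\<Sum>j\<in>X. a j * cis (2 * pi * of_int j * y)) * cis (- 2 * pi * of_int k * y))
       (\<lambda>y. g y * cis (- 2 * pi * of_int k * y)) (finite_subsets_at_top UNIV)"
    proof (rule uniform_limitI)
      fix e :: real assume "e > 0"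
      from uniform_limitD[OF unif this]
      show "\<forall>\<^sub>F X in finite_subsets_at_top UNIV. \<forall>y\<in>{0..1}. dist ((\<Sum>j\<in>X. a j * cis (2 * pi * of_int j * y)) * cis (- 2 * pi * of_int k * y)) (g y * cis (- 2 * pi * of_int k * y)) < e"
        by eventually_elim (auto simp: dist_norm norm_mult simp flip: left_diff_distrib)
    qed
    moreover have "continuous_on {0..1} (\<lambda>y. (\<Sum>j\<in>X. a j * cis (2 * pi * of_int j * y)) * cis (- 2 * pi * of_int k * y))" for X
      by (intro continuous_intros)
    ultimately obtain I J where IJ:
      "\<And>X. ((\<lambda>y. (\<Sum>j\<in>X. a j * cis (2 * pi * of_int j * y)) * cis (- 2 * pi * of_int k * y)) has_integral I X) {0..1}"
      "((\<lambda>y. g y * cis (- 2 * pi * of_int k * y)) has_integral J) {0..1}" "(I \<longlongrightarrow> J) (finite_subsets_at_top UNIV)"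
      using uniform_limit_integral finite_subsets_at_top_neq_bot by blast
    have "I = (\<lambda>X. fourier_coeff (\<lambda>y. \<Sum>j\<in>X. a j * cis (2 * pi * of_int j * y)) k)"
      unfolding fourier_coeff_def by (intro ext) (rule integral_unique[OF IJ(1), symmetric])
    moreover have "J = fourier_coeff g k"
      unfolding fourier_coeff_def by (rule integral_unique[OF IJ(2), symmetric])
    ultimately show ?thesis using IJ(3) by simp
  qed
  have fin: "fourier_coeff (\<lambda>y. \<Sum>j\<in>X. a j * cis (2 * pi * of_int j * y)) k = (if k \<in> X then a k else 0)"
    if "finite X" for X using that
  proof induction
    case (insert x X)
    have "fourier_coeff (\<lambda>y. \<Sum>j\<in>insert x X. a j * cis (2 * pi * of_int j * y)) k =
      a x * (if x = k then 1 else 0) + (if k \<in> X then a k else 0)"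
      using insert by (simp add: fc_add fc_scale fc_cis continuous_intros)
    thus ?case using insert.hyps by auto
  qed simp
  have "\<forall>\<^sub>F X in finite_subsets_at_top UNIV. finite X \<and> k \<in> X"
    unfolding eventually_finite_subsets_at_top by (rule exI[of _ "{k}"]) auto
  hence "((\<lambda>X. fourier_coeff (\<lambda>y. \<Sum>j\<in>X. a j * cis (2 * pi * of_int j * y)) k) \<longlongrightarrow> a k) (finite_subsets_at_top UNIV)"
    by (intro tendsto_eventually) (auto elim!: eventually_mono simp: fin)
  with lim show "fourier_coeff g k = a k" using tendsto_unique finite_subsets_at_top_neq_bot by blast
qed


subsection \<open>Weighted square-summable coefficient sequences\<close>

definition weighted_l2 :: "(int \<Rightarrow> complex) \<Rightarrow> bool" where
  "weighted_l2 a \<longleftrightarrow> (\<lambda>k. (cmod (a k))\<^sup>2 * (bracket k)\<^sup>2) summable_on UNIV"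
definition weighted_l2_norm :: "(int \<Rightarrow> complex) \<Rightarrow> real" where
  "weighted_l2_norm a = sqrt (\<Sum>\<^sub>\<infinity>k. (cmod (a k))\<^sup>2 * (bracket k)\<^sup>2)"

lemma bracket_minus [simp]: "bracket (- k) = bracket k"
  by (simp add: bracket_def)

lemma bracket_ge_1: "bracket k \<ge> 1"
  by (auto simp: bracket_def)

lemma L2_set_le_weighted_l2_norm:
  assumes "weighted_l2 a" "finite F"
  shows "L2_set (\<lambda>k. cmod (a k) * bracket k) F \<le> weighted_l2_norm a"
  unfolding L2_set_def weighted_l2_norm_def power_mult_distrib
  using assms by (intro real_sqrt_le_mono finite_sum_le_infsum) (auto simp: weighted_l2_def)

lemma weighted_l2I:
  assumes "\<And>F. finite F \<Longrightarrow> L2_set (\<lambda>k. cmod (a k) * bracket k) F \<le> B"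
  shows "weighted_l2 a" "weighted_l2_norm a \<le> B"
proof -
  have B: "B \<ge> 0" using assms[of "{}"] by simp
  have s: "(\<Sum>k\<in>F. (cmod (a k))\<^sup>2 * (bracket k)\<^sup>2) \<le> B\<^sup>2" if "finite F" for F
    using assms[OF that] unfolding L2_set_def power_mult_distrib by (rule sqrt_le_D)
  show w: "weighted_l2 a" unfolding weighted_l2_def
    by (rule nonneg_bdd_above_summable_on) (auto intro!: bdd_aboveI2 s)
  show "weighted_l2_norm a \<le> B" unfolding weighted_l2_norm_def
    by (rule real_le_lsqrt[OF B]) (use w s in \<open>auto simp: weighted_l2_def intro!: infsum_le_finite_sums\<close>)
qed

lemma weighted_l2_add:
  assumes "weighted_l2 a" "weighted_l2 b"
  shows "weighted_l2 (\<lambda>k. a k + b k)" "weighted_l2_norm (\<lambda>k. a k + b k) \<le> weighted_l2_norm a + weighted_l2_norm b"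
proof -
  have "L2_set (\<lambda>k. cmod (a k + b k) * bracket k) F \<le> weighted_l2_norm a + weighted_l2_norm b" if "finite F" for F
  proof -
    have "L2_set (\<lambda>k. cmod (a k + b k) * bracket k) F
        \<le> L2_set (\<lambda>k. cmod (a k) * bracket k + cmod (b k) * bracket k) F"
      using order_trans[OF zero_le_one bracket_ge_1] by (intro L2_set_mono)
        (auto simp flip: distrib_right intro!: mult_right_mono norm_triangle_ineq mult_nonneg_nonneg)
    also have "\<dots> \<le> L2_set (\<lambda>k. cmod (a k) * bracket k) F + L2_set (\<lambda>k. cmod (b k) * bracket k) F"
      by (rule L2_set_triangle_ineq)
    also have "\<dots> \<le> weighted_l2_norm a + weighted_l2_norm b" by (intro add_mono L2_set_le_weighted_l2_norm assms that)
    finally show ?thesis .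
  qed
  from weighted_l2I[OF this] show "weighted_l2 (\<lambda>k. a k + b k)" "weighted_l2_norm (\<lambda>k. a k + b k) \<le> weighted_l2_norm a + weighted_l2_norm b" by auto
qed

lemma weighted_l2_scale:
  assumes "weighted_l2 a"
  shows "weighted_l2 (\<lambda>k. c * a k)"
  using summable_on_cmult_right[of _ UNIV "(cmod c)\<^sup>2"] assms
  by (simp add: weighted_l2_def norm_mult power_mult_distrib mult.assoc)

lemma weighted_l2_norm_scale: "weighted_l2_norm (\<lambda>k. c * a k) = cmod c * weighted_l2_norm a"
  unfolding weighted_l2_norm_def norm_mult power_mult_distrib mult.assoc
  by (subst infsum_cmult_right') (simp add: real_sqrt_mult)

lemma norm_le_weighted_l2_norm:
  assumes "weighted_l2 a"
  shows "cmod (a k) \<le> weighted_l2_norm a"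
proof -
  have "cmod (a k) * 1 \<le> cmod (a k) * bracket k" by (intro mult_left_mono bracket_ge_1) simp
  also have "\<dots> \<le> weighted_l2_norm a" using L2_set_le_weighted_l2_norm[OF assms, of "{k}"] bracket_ge_1[of k] by (simp add: L2_set_def)
  finally show ?thesis by simp
qed

lemma summable_bracket: "(\<lambda>k. 1 / (bracket k)\<^sup>2) summable_on UNIV"
proof -
  have 1: "(\<lambda>n::nat. 1 / (bracket (int n))\<^sup>2) summable_on UNIV"
  proof -
    have "summable (\<lambda>n::nat. 1 / (bracket (int n))\<^sup>2)"
    proof (rule summable_cong[THEN iffD1])
      show "\<forall>\<^sub>F n in sequentially. inverse (real n ^ 2) = 1 / (bracket (int n))\<^sup>2"
        using eventually_gt_at_top[of "0::nat"] by eventually_elim (simp add: bracket_def inverse_eq_divide)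
    qed (rule inverse_power_summable, simp)
    thus ?thesis by (subst summable_on_UNIV_nonneg_real_iff) auto
  qed
  have A: "(\<lambda>k. 1 / (bracket k)\<^sup>2) summable_on range int"
    by (subst summable_on_reindex) (use 1 in \<open>auto simp: o_def inj_on_def\<close>)
  have B: "(\<lambda>k. 1 / (bracket k)\<^sup>2) summable_on range (\<lambda>n. - int n)"
    by (subst summable_on_reindex) (use 1 in \<open>auto simp: o_def inj_on_def\<close>)
  have "UNIV = range int \<union> range (\<lambda>n. - int n)"
  proof -
    have "k \<in> range int \<union> range (\<lambda>n. - int n)" for k by (cases k rule: int_cases2) auto
    thus ?thesis by auto
  qed
  thus ?thesis using summable_on_union[OF A B] by simp
qed

lemma weighted_l2_summable:
  assumes "weighted_l2 a"
  shows "(\<lambda>k. cmod (a k)) summable_on UNIV"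
proof (rule nonneg_bdd_above_summable_on)
  let ?S = "\<Sum>\<^sub>\<infinity>k. 1 / (bracket k)\<^sup>2"
  have "(\<Sum>k\<in>F. cmod (a k)) \<le> weighted_l2_norm a * sqrt ?S" if "finite F" for F
  proof -
    have b: "bracket k \<noteq> 0" for k using bracket_ge_1[of k] by auto
    have "(\<Sum>k\<in>F. cmod (a k)) = (\<Sum>k\<in>F. \<bar>cmod (a k) * bracket k\<bar> * \<bar>1 / bracket k\<bar>)"
      using b by (intro sum.cong refl) (simp add: abs_mult)
    also have "\<dots> \<le> L2_set (\<lambda>k. cmod (a k) * bracket k) F * L2_set (\<lambda>k. 1 / bracket k) F"
      by (rule L2_set_mult_ineq)
    also have "\<dots> \<le> weighted_l2_norm a * sqrt ?S"
    proof (intro mult_mono L2_set_le_weighted_l2_norm assms that)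
      show "L2_set (\<lambda>k. 1 / bracket k) F \<le> sqrt ?S"
        unfolding L2_set_def power_divide
        using summable_bracket that by (auto intro!: finite_sum_le_infsum)
      show "0 \<le> weighted_l2_norm a" unfolding weighted_l2_norm_def by (auto intro!: infsum_nonneg)
    qed simp
    finally show ?thesis .
  qed
  thus "bdd_above (sum (\<lambda>k. cmod (a k)) ` {F. F \<subseteq> UNIV \<and> finite F})" by (auto intro!: bdd_aboveI2)
qed simp

lemma norm_H1_weighted_l2_norm: "norm_H1 f = weighted_l2_norm (fourier_coeff f)"
  by (simp add: norm_H1_def weighted_l2_norm_def)

lemma H1_weighted_l2: "f \<in> H1 \<Longrightarrow> weighted_l2 (fourier_coeff f)"
  by (simp add: H1_def weighted_l2_def)

lemma H1_cont: "f \<in> H1 \<Longrightarrow> continuous_on UNIV f" by (simp add: H1_def)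

lemma H1_fc_add: "f \<in> H1 \<Longrightarrow> g \<in> H1 \<Longrightarrow> fourier_coeff (\<lambda>y. f y + g y) = (\<lambda>k. fourier_coeff f k + fourier_coeff g k)"
  by (intro ext fc_add H1_cont)

lemma H1_add: "f \<in> H1 \<Longrightarrow> g \<in> H1 \<Longrightarrow> (\<lambda>y. f y + g y) \<in> H1"
  using weighted_l2_add(1)[OF H1_weighted_l2 H1_weighted_l2, of f g] H1_fc_add[of f g]
  by (auto simp: H1_def weighted_l2_def intro: continuous_on_add)

lemma H1_scale: "f \<in> H1 \<Longrightarrow> (\<lambda>y. c * f y) \<in> H1"
  using weighted_l2_scale[OF H1_weighted_l2, of f c] 
  by (auto simp: H1_def weighted_l2_def fc_scale intro: continuous_on_mult_left)

lemma norm_H1_scale: "norm_H1 (\<lambda>y. c * f y) = cmod c * norm_H1 f"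
proof -
  have "fourier_coeff (\<lambda>y. c * f y) = (\<lambda>k. c * fourier_coeff f k)" by (intro ext fc_scale)
  thus ?thesis by (simp add: norm_H1_weighted_l2_norm weighted_l2_norm_scale)
qed

lemma H1_zero: "(\<lambda>y. 0) \<in> H1"
  by (simp add: H1_def)

lemma H1_synthesis:
  assumes "weighted_l2 a"
  obtains g where "g \<in> H1" "fourier_coeff g = a"
proof
  let ?g = "\<lambda>y. \<Sum>\<^sub>\<infinity>k::int. a k * cis (2 * pi * of_int k * y)"
  note s = fc_synthesis[OF weighted_l2_summable[OF assms]]
  show fc: "fourier_coeff ?g = a" by (rule ext) (rule s(3))
  show "?g \<in> H1" using s(1,2) fc assms by (simp add: H1_def weighted_l2_def)
qed

section \<open>The complex Banach space \<open>H\<^sup>1\<^sup>,\<^sup>+\<^sub>0\<close>\<close>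

typedef h1_plus0 = "{f \<in> H1. \<forall>k\<le>0. fourier_coeff f k = 0}"
  morphisms fun_of Abs_h1_plus0
  by (rule exI[of _ "\<lambda>_. 0"]) (simp add: H1_zero)

setup_lifting type_definition_h1_plus0

lemma fun_of_H1: "fun_of u \<in> H1" and fc_fun_of_nonpos: "k \<le> 0 \<Longrightarrow> fourier_coeff (fun_of u) k = 0"
  using fun_of[of u] by auto

instantiation h1_plus0 :: complex_normed_vector
begin

lift_definition zero_h1_plus0 :: h1_plus0 is "\<lambda>_. 0" by (simp add: H1_zero)
lift_definition plus_h1_plus0 :: "h1_plus0 \<Rightarrow> h1_plus0 \<Rightarrow> h1_plus0" is "\<lambda>f g y. f y + g y"
  by (simp add: H1_add H1_fc_add)
lift_definition scaleC_h1_plus0 :: "complex \<Rightarrow> h1_plus0 \<Rightarrow> h1_plus0" is "\<lambda>c f y. c * f y"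
  by (simp add: H1_scale fc_scale)
definition "- (u :: h1_plus0) = (-1) *\<^sub>C u"
definition "(u :: h1_plus0) - v = u + - v"
definition "r *\<^sub>R (u :: h1_plus0) = complex_of_real r *\<^sub>C u"
lift_definition norm_h1_plus0 :: "h1_plus0 \<Rightarrow> real" is norm_H1 .
definition "dist (u :: h1_plus0) v = norm (u - v)"
definition "sgn (u :: h1_plus0) = complex_of_real (inverse (norm u)) *\<^sub>C u"
definition [code del]: "(uniformity :: (h1_plus0 \<times> h1_plus0) filter) = (INF e\<in>{0<..}. principal {(u, v). dist u v < e})"
definition "open (U :: h1_plus0 set) \<longleftrightarrow> (\<forall>u\<in>U. \<forall>\<^sub>F (u', v) in uniformity. u' = u \<longrightarrow> v \<in> U)"

instance
proof
  fix a b :: complex and r s :: real and x y z :: h1_plus0 and U :: "h1_plus0 set"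
  note d = uminus_h1_plus0_def minus_h1_plus0_def scaleR_h1_plus0_def
  show "x + y + z = x + (y + z)" by transfer (simp add: add.assoc)
  show "x + y = y + x" by transfer (simp add: add.commute)
  show "0 + x = x" by transfer simp
  show "- x + x = 0" unfolding d by transfer simp
  show "x - y = x + - y" by (fact minus_h1_plus0_def)
  show "r *\<^sub>R (x + y) = r *\<^sub>R x + r *\<^sub>R y" unfolding d by transfer (simp add: distrib_left)
  show "(r + s) *\<^sub>R x = r *\<^sub>R x + s *\<^sub>R x" unfolding d by transfer (simp add: distrib_right)
  show "r *\<^sub>R s *\<^sub>R x = (r * s) *\<^sub>R x" unfolding d by transfer (simp add: mult.assoc)
  show "1 *\<^sub>R x = x" unfolding d by transfer simp
  show "dist x y = norm (x - y)" by (fact dist_h1_plus0_def)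
  show "sgn x = inverse (norm x) *\<^sub>R x" by (simp only: sgn_h1_plus0_def scaleR_h1_plus0_def)
  show "(uniformity :: (h1_plus0 \<times> h1_plus0) filter) = (INF e\<in>{0<..}. principal {(u, v). dist u v < e})"
    by (fact uniformity_h1_plus0_def)
  show "open U \<longleftrightarrow> (\<forall>u\<in>U. \<forall>\<^sub>F (u', v) in uniformity. u' = u \<longrightarrow> v \<in> U)"
    by (fact open_h1_plus0_def)
  show "norm x = 0 \<longleftrightarrow> x = 0"
  proof transfer
    fix f assume f: "f \<in> H1 \<and> (\<forall>k\<le>0. fourier_coeff f k = 0)"
    show "norm_H1 f = 0 \<longleftrightarrow> f = (\<lambda>_. 0)"
    proof
      assume "norm_H1 f = 0"
      hence "fourier_coeff f k = 0" for k
        using norm_le_weighted_l2_norm[OF H1_weighted_l2, of f k] f by (simp add: norm_H1_weighted_l2_norm)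
      moreover have "continuous_on UNIV f" "\<And>y. f (y + 1) = f y" using f by (auto simp: H1_def)
      ultimately have "f y = 0" for y using fc_unique_zero[of f y] by blast
      thus "f = (\<lambda>_. 0)" by (rule ext)
    next
      assume "f = (\<lambda>_. 0)"
      thus "norm_H1 f = 0" unfolding norm_H1_def by simp
    qed
  qed
  show "norm (x + y) \<le> norm x + norm y"
    by transfer (simp add: norm_H1_weighted_l2_norm H1_fc_add weighted_l2_add H1_weighted_l2)
  have n: "norm (c *\<^sub>C u) = cmod c * norm u" for c and u :: h1_plus0
    unfolding norm_h1_plus0.rep_eq scaleC_h1_plus0.rep_eq by (rule norm_H1_scale)
  show "norm (a *\<^sub>C x) = cmod a * norm x" by (rule n)
  show "norm (r *\<^sub>R x) = \<bar>r\<bar> * norm x" by (simp add: scaleR_h1_plus0_def n)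
  show "a *\<^sub>C (x + y) = a *\<^sub>C x + a *\<^sub>C y" by transfer (simp add: distrib_left)
  show "(a + b) *\<^sub>C x = a *\<^sub>C x + b *\<^sub>C x" by transfer (simp add: distrib_right)
  show "a *\<^sub>C b *\<^sub>C x = (a * b) *\<^sub>C x" by transfer (simp add: mult.assoc)
  show "complex_of_real r *\<^sub>C x = r *\<^sub>R x" by (simp add: scaleR_h1_plus0_def)
qed

end

lemma fc_fun_of_diff:
  "fourier_coeff (fun_of (u - v)) k = fourier_coeff (fun_of u) k - fourier_coeff (fun_of v) k"
proof -
  have "fun_of (u - v) = (\<lambda>y. fun_of u y + (-1) * fun_of v y)"
    unfolding minus_h1_plus0_def uminus_h1_plus0_def plus_h1_plus0.rep_eq scaleC_h1_plus0.rep_eq ..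
  thus ?thesis
    using fc_add[of "fun_of u" "\<lambda>y. (-1) * fun_of v y" k] fc_scale[of "-1" "fun_of v" k]
    using H1_cont[OF H1_scale[OF fun_of_H1[of v], of "-1"]] H1_cont[OF fun_of_H1[of u]] by simp
qed

instance h1_plus0 :: complex_banach
proof
  fix X :: "nat \<Rightarrow> h1_plus0"
  assume X: "Cauchy X"
  define c where "c n = fourier_coeff (fun_of (X n))" for n
  have c: "weighted_l2 (c n)" for n by (simp add: c_def H1_weighted_l2 fun_of_H1)
  have norm_weighted_l2_norm: "norm u = weighted_l2_norm (fourier_coeff (fun_of u))" for u :: h1_plus0
    by (simp add: norm_h1_plus0.rep_eq norm_H1_weighted_l2_norm)
  have diff: "fourier_coeff (fun_of (X m - X n)) = (\<lambda>k. c m k - c n k)" for m n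
    by (simp add: c_def fc_fun_of_diff fun_eq_iff)
  have wd: "weighted_l2 (\<lambda>k. c m k - c n k)" for m n
    unfolding diff[symmetric] by (intro H1_weighted_l2 fun_of_H1)
  have "Cauchy (\<lambda>n. c n k)" for k
  proof (rule CauchyI)
    fix e :: real assume "e > 0"
    then obtain M where M: "\<And>m n. m \<ge> M \<Longrightarrow> n \<ge> M \<Longrightarrow> norm (X m - X n) < e"
      using CauchyD[OF X] by blast
    have "cmod (c m k - c n k) < e" if "m \<ge> M" "n \<ge> M" for m n
      using norm_le_weighted_l2_norm[OF wd[of m n], of k] M[OF that] by (simp add: norm_weighted_l2_norm diff)
    thus "\<exists>M. \<forall>m\<ge>M. \<forall>n\<ge>M. cmod (c m k - c n k) < e" by blast
  qed
  hence "\<forall>k. \<exists>l. (\<lambda>n. c n k) \<longlonglongrightarrow> l" using Cauchy_convergent convergent_def by blast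
  then obtain a where a: "\<And>k. (\<lambda>n. c n k) \<longlonglongrightarrow> a k" by metis
  have key: "\<exists>M. \<forall>n\<ge>M. weighted_l2 (\<lambda>k. c n k - a k) \<and> weighted_l2_norm (\<lambda>k. c n k - a k) \<le> e" if e: "e > 0" for e
  proof -
    obtain M where M: "\<And>m n. m \<ge> M \<Longrightarrow> n \<ge> M \<Longrightarrow> norm (X m - X n) < e"
      using CauchyD[OF X e] by blast
    have "L2_set (\<lambda>k. cmod (c n k - a k) * bracket k) F \<le> e" if "n \<ge> M" "finite F" for n F
    proof (rule tendsto_upperbound)
      show "(\<lambda>m. L2_set (\<lambda>k. cmod (c n k - c m k) * bracket k) F) \<longlonglongrightarrow>
              L2_set (\<lambda>k. cmod (c n k - a k) * bracket k) F"
        unfolding L2_set_def by (intro tendsto_intros a)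
      show "\<forall>\<^sub>F m in sequentially. L2_set (\<lambda>k. cmod (c n k - c m k) * bracket k) F \<le> e"
        using eventually_ge_at_top[of M]
      proof eventually_elim
        case (elim m)
        show ?case using L2_set_le_weighted_l2_norm[OF wd[of n m] that(2)] M[OF that(1) elim] by (simp add: norm_weighted_l2_norm diff)
      qed
    qed simp
    from weighted_l2I[OF this] show ?thesis by blast
  qed
  obtain n where "weighted_l2 (\<lambda>k. c n k - a k)" using key[of 1] by auto
  from weighted_l2_add(1)[OF c[of n] weighted_l2_scale[OF this, of "-1"]] have "weighted_l2 a" by simp
  then obtain g where g: "g \<in> H1" "fourier_coeff g = a" by (rule H1_synthesis)
  have "a k = 0" if "k \<le> 0" for k
    using a[of k] that by (simp add: c_def fc_fun_of_nonpos LIMSEQ_const_iff)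
  hence G: "fun_of (Abs_h1_plus0 g) = g" using g by (intro Abs_h1_plus0_inverse) auto
  have "X \<longlonglongrightarrow> Abs_h1_plus0 g"
  proof (rule LIMSEQ_I)
    fix e :: real assume e: "e > 0"
    have "norm (X n - Abs_h1_plus0 g) = weighted_l2_norm (\<lambda>k. c n k - a k)" for n
      unfolding norm_weighted_l2_norm by (rule arg_cong[where f=weighted_l2_norm]) (simp add: fun_eq_iff fc_fun_of_diff G g c_def)
    moreover obtain M where "\<forall>n\<ge>M. weighted_l2_norm (\<lambda>k. c n k - a k) \<le> e / 2"
      using key[of "e/2"] e by auto
    ultimately have "\<forall>n\<ge>M. norm (X n - Abs_h1_plus0 g) < e" using e by fastforce
    thus "\<exists>M. \<forall>n\<ge>M. norm (X n - Abs_h1_plus0 g) < e" ..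
  qed
  thus "convergent X" by (auto simp: convergent_def)
qed

section \<open>The momentum map\<close>

text \<open>The Fourier series of an element of \<open>H\<^sup>1\<close> converges absolutely, hence its truncations can
  be defined pointwise.\<close>

definition Pi_plus :: "(real \<Rightarrow> complex) \<Rightarrow> real \<Rightarrow> complex" where
  "Pi_plus f y = (\<Sum>\<^sub>\<infinity>k\<in>{0::int..}. fourier_coeff f k * cis (2 * pi * of_int k * y))"

definition Pi_plus0 :: "(real \<Rightarrow> complex) \<Rightarrow> real \<Rightarrow> complex" where
  "Pi_plus0 f y = (\<Sum>\<^sub>\<infinity>k\<in>{1::int..}. fourier_coeff f k * cis (2 * pi * of_int k * y))"

definition pairing :: "(real \<Rightarrow> complex) \<Rightarrow> (real \<Rightarrow> complex) \<Rightarrow> complex" where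
  "pairing f g = (\<Sum>\<^sub>\<infinity>k::int. fourier_coeff f k * fourier_coeff g k)"

definition shift :: "(real \<Rightarrow> complex) \<Rightarrow> real \<Rightarrow> complex" where
  "shift f y = f y * cis (- 2 * pi * y)"

definition A_op :: "nat \<Rightarrow> (real \<Rightarrow> complex) \<Rightarrow> (real \<Rightarrow> complex) \<Rightarrow> real \<Rightarrow> complex" where
  "A_op k w g y = g y * Pi_plus ((shift ^^ (k + 1)) w) y - w y * Pi_plus ((shift ^^ (k + 1)) g) y"

definition Gamma_op :: "(real \<Rightarrow> complex) \<Rightarrow> (real \<Rightarrow> complex) \<Rightarrow> real \<Rightarrow> complex" where
  "Gamma_op w p = Pi_plus0 (\<lambda>y. w y * p (- y))"

definition I_coeff :: "nat \<Rightarrow> (real \<Rightarrow> complex) \<Rightarrow> (real \<Rightarrow> complex) \<Rightarrow> complex" where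
  "I_coeff k w p = pairing (A_op k w (Gamma_op w p)) p"

definition U_coeff :: "(real \<Rightarrow> complex) \<Rightarrow> nat \<Rightarrow> (real \<Rightarrow> complex) \<Rightarrow> complex" where
  "U_coeff f k w = - fourier_coeff (\<lambda>y. w y * Pi_plus0 (\<lambda>x. f x / w x) y) (int (k + 1))"

definition J_coeff ::
  "(real \<Rightarrow> complex) \<Rightarrow> nat \<Rightarrow> (real \<Rightarrow> complex) \<Rightarrow> (real \<Rightarrow> complex) \<Rightarrow> complex" where
  "J_coeff f k w p = I_coeff k w p + U_coeff f k w"

definition nonvanishing :: "h1_plus0 set" where
  "nonvanishing = {w. \<forall>y. fun_of w y \<noteq> 0}"

definition momentum_map :: "(real \<Rightarrow> complex) \<Rightarrow> h1_plus0 \<times> h1_plus0 \<Rightarrow> h1_plus0" where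
  "momentum_map f = (\<lambda>(w, p). THE g. \<forall>k::nat. k \<ge> 1 \<longrightarrow>
     fourier_coeff (fun_of g) (int k) = J_coeff f k (fun_of w) (fun_of p))"

end

theory Submission
  imports Defs
begin

text \<open>
  Write \<open>p'(y) = p(-y)\<close>. Since \<open>\<langle>u, p\<rangle>\<close> is the zeroth coefficient of \<open>u p'\<close>, the \<open>(k+1)\<close>-fold
  shift in \<open>A\<^sub>k\<close> can be moved out of the pairing: with \<open>g = \<Gamma>(w)p\<close> and \<open>N\<close> the projection onto the
  frequencies \<open>\<le> 0\<close>, \<open>J\<^sub>k(w, p)\<close> is the \<open>(k+1)\<close>-st coefficient of
  \<open>w N(g p') - g N(w p') - w \<Pi>\<^sub>0\<^sup>+(f/w)\<close>.
  This function lies in \<open>H\<^sup>1\<close> because \<open>H\<^sup>1\<close> is an algebra containing the inverses of its nowhere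
  vanishing elements. It is built from bounded linear maps, products and \<open>w \<mapsto> 1/w\<close>, all of which are
  given locally by normally convergent power series, the last one by a Neumann series.
\<close>

section \<open>Fourier series of functions in \<open>H\<^sup>1\<close>\<close>

text \<open>Two obstacles shape the proof. The numbers \<open>J_coeff f k w p\<close> are given one
  by one, and bounding each of them separately does not give weighted summability in
  \<open>k\<close>. Exhibiting them as coefficients of one function in \<open>H1\<close> settles
  this at once, and lowering the index by one costs nothing, because for \<open>k >= 1\<close> the
  weight of \<open>k\<close> is at most that of \<open>k + 1\<close>. Moreover \<open>f\<close>,
  \<open>1/w\<close> and the reflected \<open>p\<close> are not confined to positive frequencies, so
  the calculations take place in an auxiliary type \<open>h1\<close> for all of \<open>H1\<close>,
  and only the last map lands in \<open>h1_plus0\<close>. Uniform convergence of two series does not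
  directly justify multiplying them. Power series therefore carry explicit norm bounds
  \<open>K n\<close> with \<open>K n * r ^ n\<close> summable, a property that survives Cauchy
  products and implies the uniform convergence demanded by
  \<open>complex_analytic_on\<close>.\<close>

lemma H1_periodic: "f \<in> H1 \<Longrightarrow> f (y + 1) = f y"
  by (simp add: H1_def)

lemma fc_diff:
  assumes "continuous_on UNIV f" "continuous_on UNIV g"
  shows "fourier_coeff (\<lambda>y. f y - g y) k = fourier_coeff f k - fourier_coeff g k"
  using fc_add[of f "\<lambda>y. (-1) * g y" k] fc_scale[of "-1" g k] assms
  by (simp add: continuous_on_minus)

lemma fc_eqI:
  assumes "continuous_on UNIV f" "\<And>y. f (y + 1) = f y"
    and "continuous_on UNIV g" "\<And>y. g (y + 1) = g y"
    and "\<And>k. fourier_coeff f k = fourier_coeff g k"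
  shows "f = g"
proof
  fix y
  have "(\<lambda>y. f y - g y) y = 0"
    by (rule fc_unique_zero) (use assms in \<open>auto simp: fc_diff intro: continuous_on_diff\<close>)
  then show "f y = g y" by simp
qed

lemma H1_eqI: "f \<in> H1 \<Longrightarrow> g \<in> H1 \<Longrightarrow> (\<And>k. fourier_coeff f k = fourier_coeff g k) \<Longrightarrow> f = g"
  by (rule fc_eqI) (auto simp: H1_def)

lemma H1_fourier_abs_summable:
  assumes "f \<in> H1"
  shows "(\<lambda>k. cmod (fourier_coeff f k)) summable_on UNIV"
  using assms by (intro weighted_l2_summable H1_weighted_l2)

text \<open>Absolutely summable coefficients make the series a continuous periodic function with the
  same coefficients as \<open>f\<close>, and uniqueness of coefficients identifies the two. No
  summation kernel is involved.\<close>

lemma H1_fourier_series: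
  assumes "f \<in> H1"
  shows "((\<lambda>k. fourier_coeff f k * cis (2 * pi * of_int k * y)) has_sum f y) UNIV"
proof -
  note s = fc_synthesis[OF H1_fourier_abs_summable[OF assms]]
  have "f = (\<lambda>y. \<Sum>\<^sub>\<infinity>k. fourier_coeff f k * cis (2 * pi * of_int k * y))"
    by (rule fc_eqI) (use assms s in \<open>auto simp: H1_def\<close>)
  moreover have "(\<lambda>k. fourier_coeff f k * cis (2 * pi * of_int k * y)) summable_on UNIV"
    by (rule abs_summable_summable) (simp add: norm_mult H1_fourier_abs_summable assms)
  ultimately show ?thesis
    by (metis (no_types, lifting) has_sum_infsum)
qed

text \<open>The series of \<open>f\<close> converges uniformly, so it may be multiplied by the
  bounded function \<open>g\<close> and integrated term by term. Keeping \<open>g\<close> merely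
  continuous lets Bessel's inequality reach functions not yet known to lie in
  \<open>H1\<close>.\<close>

lemma has_sum_fc_mult:
  assumes f: "f \<in> H1" and g: "continuous_on UNIV g"
  shows "((\<lambda>j. fourier_coeff f j * fourier_coeff g (k - j)) has_sum fourier_coeff (\<lambda>y. f y * g y) k) UNIV"
proof -
  let ?S = "\<lambda>X y. (\<Sum>j\<in>X. fourier_coeff f j * cis (2 * pi * of_int j * y)) * (g y * cis (- 2 * pi * of_int k * y))"
  have g': "continuous_on A g" for A using g continuous_on_subset by blast
  have unif: "uniform_limit {0..1} (\<lambda>X y. \<Sum>j\<in>X. fourier_coeff f j * cis (2 * pi * of_int j * y)) f (finite_subsets_at_top UNIV)"
    by (rule Weierstrass_m_test_general'[OF _ H1_fourier_series[OF f] H1_fourier_abs_summable[OF f]])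
       (simp add: norm_mult)
  have "uniform_limit {0..1} ?S (\<lambda>y. f y * (g y * cis (- 2 * pi * of_int k * y))) (finite_subsets_at_top UNIV)"
  proof (rule uniform_lim_mult[OF unif uniform_limit_const])
    show "bounded (f ` {0..1})"
      using H1_cont[OF f] continuous_on_subset compact_continuous_image[of "{0..1}" f]
      by (auto intro: compact_imp_bounded)
    have "continuous_on {0..1} (\<lambda>y. g y * cis (- 2 * pi * of_int k * y))"
      by (intro continuous_intros g')
    then show "bounded ((\<lambda>y. g y * cis (- 2 * pi * of_int k * y)) ` {0..1})"
      by (intro compact_imp_bounded compact_continuous_image) auto
  qed
  moreover have "continuous_on {0..1} (?S X)" for X
    by (intro continuous_intros g')
  ultimately obtain I J where IJ:
    "\<And>X. (?S X has_integral I X) {0..1}"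
    "((\<lambda>y. f y * (g y * cis (- 2 * pi * of_int k * y))) has_integral J) {0..1}"
    "(I \<longlongrightarrow> J) (finite_subsets_at_top UNIV)"
    using uniform_limit_integral finite_subsets_at_top_neq_bot by blast
  have "I = (\<lambda>X. \<Sum>j\<in>X. fourier_coeff f j * fourier_coeff g (k - j))"
  proof
    fix X
    have "I X = integral {0..1} (\<lambda>y. \<Sum>j\<in>X. fourier_coeff f j * (g y * cis (- 2 * pi * of_int (k - j) * y)))"
      unfolding integral_unique[OF IJ(1), symmetric] sum_distrib_right
      by (intro arg_cong[where f="integral _"] ext sum.cong refl)
         (simp add: mult_ac cis_mult algebra_simps)
    also have "\<dots> = (\<Sum>j\<in>X. fourier_coeff f j * fourier_coeff g (k - j))"
      unfolding fourier_coeff_def[of g]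
      by (cases "finite X", subst integral_sum)
         (auto intro!: integrable_continuous_interval continuous_intros g')
    finally show "I X = (\<Sum>j\<in>X. fourier_coeff f j * fourier_coeff g (k - j))" .
  qed
  moreover have "J = fourier_coeff (\<lambda>y. f y * g y) k"
    using IJ(2) by (simp add: fourier_coeff_def mult.assoc integral_unique)
  ultimately show ?thesis using IJ(3) by (simp add: has_sum_def)
qed

section \<open>Parseval's identity and Bessel's inequality\<close>

lemma fc_cnj: "fourier_coeff (\<lambda>y. cnj (g y)) k = cnj (fourier_coeff g (- k))"
  by (simp add: fourier_coeff_def integral_cnj cis_cnj)

lemma fc_0_mult_cnj:
  "fourier_coeff (\<lambda>y. g y * cnj (g y)) 0 = of_real (integral {0..1} (\<lambda>y. (cmod (g y))\<^sup>2))"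
  if "continuous_on UNIV g"
proof -
  have "continuous_on {0..1} g" using that continuous_on_subset by blast
  then show ?thesis
    using integral_linear[OF _ bounded_linear_of_real[where 'a=complex], of "\<lambda>y. (cmod (g y))\<^sup>2" "{0..1}"]
    by (simp add: fourier_coeff_def complex_norm_square[symmetric] o_def
        integrable_continuous_interval continuous_intros)
qed

text \<open>The convolution formula at frequency 0, with the conjugate of \<open>f\<close> as second
  factor: conjugation reflects frequencies, so the terms become squared moduli.\<close>

lemma Parseval:
  assumes "f \<in> H1"
  shows "((\<lambda>k. (cmod (fourier_coeff f k))\<^sup>2) has_sum integral {0..1} (\<lambda>y. (cmod (f y))\<^sup>2)) UNIV"
proof -
  have "((\<lambda>k. complex_of_real ((cmod (fourier_coeff f k))\<^sup>2)) has_sum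
      of_real (integral {0..1} (\<lambda>y. (cmod (f y))\<^sup>2))) UNIV"
    using has_sum_fc_mult[OF assms continuous_on_cnj[OF H1_cont[OF assms]], of 0]
    unfolding fc_0_mult_cnj[OF H1_cont[OF assms]] fc_cnj
    by (simp add: complex_norm_square[symmetric])
  from has_sum_bounded_linear[OF bounded_linear_Re this] show ?thesis by (simp add: o_def)
qed

text \<open>The partial Fourier sum \<open>s\<close> of \<open>g\<close> over \<open>F\<close> is a
  trigonometric polynomial, hence in \<open>H1\<close>, and the L2 norm of \<open>g - s\<close> is
  nonnegative.\<close>

lemma Bessel_inequality:
  assumes g: "continuous_on UNIV g" and F: "finite F"
  shows "(\<Sum>k\<in>F. (cmod (fourier_coeff g k))\<^sup>2) \<le> integral {0..1} (\<lambda>y. (cmod (g y))\<^sup>2)"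
proof -
  let ?a = "\<lambda>k. if k \<in> F then fourier_coeff g k else 0"
  let ?Q = "\<Sum>k\<in>F. (cmod (fourier_coeff g k))\<^sup>2"
  have "weighted_l2 ?a"
    unfolding weighted_l2_def
    by (rule summable_on_cong_neutral[where T=F, THEN iffD2]) (use F in auto)
  then obtain s where s: "s \<in> H1" "fourier_coeff s = ?a" by (rule H1_synthesis)
  note sc = H1_cont[OF s(1)]
  have fin: "(\<Sum>\<^sub>\<infinity>k. if k \<in> F then h k else 0) = (\<Sum>k\<in>F. h k)" for h :: "int \<Rightarrow> complex"
    using F by (subst infsum_cong_neutral[where T=F and g=h]) auto
  have Q: "complex_of_real ?Q = (\<Sum>k\<in>F. fourier_coeff g k * cnj (fourier_coeff g k))"
    by (simp add: complex_norm_square[symmetric])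
  have sg: "fourier_coeff (\<lambda>y. s y * cnj (g y)) 0 = of_real ?Q"
    unfolding Q using infsumI[OF has_sum_fc_mult[OF s(1) continuous_on_cnj[OF g], of 0]]
    by (simp add: s fc_cnj if_distrib[of "\<lambda>x. x * _"] fin cong: if_cong)
  have ss: "fourier_coeff (\<lambda>y. s y * cnj (s y)) 0 = of_real ?Q"
    unfolding Q using infsumI[OF has_sum_fc_mult[OF s(1) continuous_on_cnj[OF sc], of 0]]
    by (simp add: s fc_cnj if_distrib[of "\<lambda>x. x * _"] fin cong: if_cong)
  have gs: "fourier_coeff (\<lambda>y. g y * cnj (s y)) 0 = of_real ?Q"
    using arg_cong[OF sg, of cnj] fc_cnj[of "\<lambda>y. s y * cnj (g y)" 0] by (simp add: mult.commute)
  have c: "continuous_on UNIV (\<lambda>y. g y * cnj (g y))" "continuous_on UNIV (\<lambda>y. s y * cnj (g y))"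
    "continuous_on UNIV (\<lambda>y. g y * cnj (s y))" "continuous_on UNIV (\<lambda>y. s y * cnj (s y))"
    by (intro continuous_intros g sc)+
  \<comment> \<open>In the expansion of the squared modulus of \<open>g - s\<close>, each of the
    three terms containing \<open>s\<close> has integral \<open>?Q\<close>; with their signs they
    contribute \<open>- ?Q\<close> in total.\<close>
  have "(\<lambda>y. (g y - s y) * cnj (g y - s y))
      = (\<lambda>y. ((g y * cnj (g y) - s y * cnj (g y)) - g y * cnj (s y)) + s y * cnj (s y))"
    by (simp add: algebra_simps)
  then have "fourier_coeff (\<lambda>y. (g y - s y) * cnj (g y - s y)) 0
      = fourier_coeff (\<lambda>y. ((g y * cnj (g y) - s y * cnj (g y)) - g y * cnj (s y)) + s y * cnj (s y)) 0"
    by (rule arg_cong)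
  then have "complex_of_real (integral {0..1} (\<lambda>y. (cmod (g y - s y))\<^sup>2))
      = of_real (integral {0..1} (\<lambda>y. (cmod (g y))\<^sup>2)) - of_real ?Q"
    by (simp only: fc_add fc_diff continuous_on_diff c sg ss gs fc_0_mult_cnj[OF g]
        fc_0_mult_cnj[OF continuous_on_diff[OF g sc]] diff_add_cancel)
  then have "integral {0..1} (\<lambda>y. (cmod (g y - s y))\<^sup>2) = integral {0..1} (\<lambda>y. (cmod (g y))\<^sup>2) - ?Q"
    unfolding of_real_diff[symmetric] of_real_eq_iff .
  moreover have "integral {0..1} (\<lambda>y. (cmod (g y - s y))\<^sup>2) \<ge> 0"
    by (rule integral_nonneg)
       (auto intro!: integrable_continuous_interval continuous_intros
          continuous_on_subset[OF g] continuous_on_subset[OF sc])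
  ultimately show ?thesis by simp
qed

section \<open>Translates of periodic functions\<close>

lemma integral_periodic_shift:
  fixes F :: "real \<Rightarrow> complex"
  assumes F: "continuous_on UNIV F" and per: "\<And>y. F (y + 1) = F y" and h: "0 \<le> h" "h \<le> 1"
  shows "integral {0..1} (\<lambda>y. F (y + h)) = integral {0..1} F"
proof -
  have int: "F integrable_on {a..b}" for a b
    using F continuous_on_subset by (blast intro: integrable_continuous_interval)
  have "integral {0..1} (\<lambda>y. F (y + h)) = integral {h..1 + h} F"
    using integral_shift_Icc_real[of 0 1 F h] by (simp add: o_def add.commute)
  also have "\<dots> = integral {h..1} F + integral {1..1 + h} F"
    using h int by (intro Henstock_Kurzweil_Integration.integral_combine[symmetric]) auto
  also have "integral {1..1 + h} F = integral {0..h} F"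
    using integral_shift_Icc_real[of 0 h F 1] per by (simp add: o_def add.commute)
  also have "integral {h..1} F + integral {0..h} F = integral {0..1} F"
    using h int by (subst add.commute, intro Henstock_Kurzweil_Integration.integral_combine) auto
  finally show ?thesis .
qed

lemma fc_translate:
  assumes f: "continuous_on UNIV f" and per: "\<And>y. f (y + 1) = f y" and h: "0 \<le> h" "h \<le> 1"
  shows "fourier_coeff (\<lambda>y. f (y + h)) k = cis (2 * pi * of_int k * h) * fourier_coeff f k"
proof -
  let ?F = "\<lambda>y. f y * cis (- 2 * pi * of_int k * y)"
  have "cis (- 2 * pi * of_int k * (y + 1)) = cis (- 2 * pi * of_int k * y)" for y
  proof -
    have "cis (- 2 * pi * of_int k * (y + 1)) = cis (2 * pi * of_int (- k)) * cis (- 2 * pi * of_int k * y)"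
      unfolding cis_mult by (simp add: algebra_simps)
    then show ?thesis by (simp only: cis_multiple_2pi Ints_of_int mult_1_left)
  qed
  then have "integral {0..1} (\<lambda>y. ?F (y + h)) = integral {0..1} ?F"
    by (intro integral_periodic_shift continuous_intros h f) (simp add: per)
  moreover have "(\<lambda>y. f (y + h) * cis (- 2 * pi * of_int k * y)) = (\<lambda>y. cis (2 * pi * of_int k * h) * ?F (y + h))"
    by (simp add: cis_mult mult_ac algebra_simps)
  ultimately show ?thesis
    by (simp add: fourier_coeff_def)
qed

section \<open>Products and inverses in \<open>H\<^sup>1\<close>\<close>

text \<open>The square summability of \<open>k f\<^sub>k\<close> is read off the bound \<open>\<parallel>f(\<cdot> + h) - f\<parallel>\<^sub>L\<^sub>2 = O(h)\<close>,
  which, unlike the Fourier coefficients themselves, behaves well under products and inverses.\<close>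

lemma H1I_translation:
  assumes cont: "continuous_on UNIV f" and per: "\<And>y. f (y + 1) = f y"
    and M: "\<And>y. cmod (f y) \<le> M" and B: "B \<ge> 0"
    and trans: "\<And>h. 0 < h \<Longrightarrow> h \<le> 1 \<Longrightarrow> integral {0..1} (\<lambda>y. (cmod (f (y + h) - f y))\<^sup>2) \<le> (B * h)\<^sup>2"
  shows "f \<in> H1" "norm_H1 f \<le> M + B"
proof -
  have M0: "M \<ge> 0" using M[of 0] norm_ge_zero order_trans by blast
  have cont_h: "continuous_on UNIV (\<lambda>y. f (y + h))" for h
    by (intro continuous_on_compose2[OF cont] continuous_intros) auto
  \<comment> \<open>Bessel's inequality is applied to the difference quotient of \<open>f\<close>
    with step \<open>h\<close>, whose coefficients are those of \<open>f\<close> times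
    \<open>?d k h\<close>. On the finite set \<open>F\<close> the limit from the right at
    \<open>h = 0\<close> turns \<open>?d k h\<close> into 2 pi i k.\<close>
  have diffquot: "(\<Sum>k\<in>F. (cmod (fourier_coeff f k))\<^sup>2 * (2 * pi * of_int k)\<^sup>2) \<le> B\<^sup>2" if F: "finite F" for F
  proof (rule tendsto_upperbound)
    let ?d = "\<lambda>k h. (cis (2 * pi * of_int k * h) - 1) / of_real h"
    have "((\<lambda>h. cmod (?d k h)) \<longlongrightarrow> cmod (\<i> * of_real (2 * pi * of_int k))) (at_right 0)" for k
    proof -
      have "((\<lambda>h. exp (\<i> * of_real (2 * pi * of_int k) * h)) has_field_derivative \<i> * of_real (2 * pi * of_int k)) (at 0)"
        by (auto intro!: derivative_eq_intros)
      then have "((\<lambda>h. (exp (\<i> * of_real (2 * pi * of_int k) * h) - 1) / h) \<longlongrightarrow> \<i> * of_real (2 * pi * of_int k)) (at 0)"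
        by (simp add: has_field_derivative_iff)
      moreover have "filterlim complex_of_real (at 0) (at_right 0)"
        unfolding filterlim_at by (auto intro!: tendsto_eq_intros simp: eventually_at_filter)
      ultimately have "((\<lambda>h. (exp (\<i> * of_real (2 * pi * of_int k) * of_real h) - 1) / of_real h)
          \<longlongrightarrow> \<i> * of_real (2 * pi * of_int k)) (at_right (0::real))"
        by (rule filterlim_compose)
      then show ?thesis
        by (intro tendsto_norm) (simp add: cis_conv_exp mult.assoc)
    qed
    then have "((\<lambda>h. \<Sum>k\<in>F. (cmod (fourier_coeff f k))\<^sup>2 * (cmod (?d k h))\<^sup>2) \<longlongrightarrow>
        (\<Sum>k\<in>F. (cmod (fourier_coeff f k))\<^sup>2 * (cmod (\<i> * of_real (2 * pi * of_int k)))\<^sup>2)) (at_right 0)"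
      by (intro tendsto_sum tendsto_mult tendsto_power tendsto_const)
    then show "((\<lambda>h. \<Sum>k\<in>F. (cmod (fourier_coeff f k))\<^sup>2 * (cmod (?d k h))\<^sup>2) \<longlongrightarrow>
        (\<Sum>k\<in>F. (cmod (fourier_coeff f k))\<^sup>2 * (2 * pi * of_int k)\<^sup>2)) (at_right 0)"
      by (simp add: norm_mult power_mult_distrib)
    have "(\<Sum>k\<in>F. (cmod (fourier_coeff f k))\<^sup>2 * (cmod (?d k h))\<^sup>2) \<le> B\<^sup>2" if h: "0 < h" "h \<le> 1" for h
    proof -
      have "fourier_coeff (\<lambda>y. f (y + h) - f y) k = fourier_coeff f k * (cis (2 * pi * of_int k * h) - 1)" for k
        using h cont per by (simp add: fc_diff cont_h fc_translate algebra_simps)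
      then have "(\<Sum>k\<in>F. (cmod (fourier_coeff f k))\<^sup>2 * (cmod (cis (2 * pi * of_int k * h) - 1))\<^sup>2)
          \<le> integral {0..1} (\<lambda>y. (cmod (f (y + h) - f y))\<^sup>2)"
        using Bessel_inequality[OF continuous_on_diff[OF cont_h[of h] cont] F]
        by (simp add: norm_mult power_mult_distrib)
      also have "\<dots> \<le> (B * h)\<^sup>2" by (rule trans[OF h])
      finally have "(\<Sum>k\<in>F. (cmod (fourier_coeff f k))\<^sup>2 * (cmod (cis (2 * pi * of_int k * h) - 1))\<^sup>2) / h\<^sup>2 \<le> B\<^sup>2"
        using h by (simp add: divide_le_eq power_mult_distrib)
      then show ?thesis
        by (simp add: norm_divide power_divide sum_divide_distrib)
    qed
    then show "\<forall>\<^sub>F h in at_right 0. (\<Sum>k\<in>F. (cmod (fourier_coeff f k))\<^sup>2 * (cmod (?d k h))\<^sup>2) \<le> B\<^sup>2"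
      by (intro eventually_at_rightI[of 0 1]) auto
  qed simp
  have c0: "cmod (fourier_coeff f 0) \<le> M"
    using integral_bound[of 0 1 f M] M continuous_on_subset[OF cont]
    by (simp add: fourier_coeff_def)
  have "L2_set (\<lambda>k. cmod (fourier_coeff f k) * bracket k) F \<le> M + B" if F: "finite F" for F
  proof -
    \<comment> \<open>Differences do not see the frequency 0, which nevertheless has weight 1; it is
      charged to the sup bound \<open>M\<close>. At the other frequencies a factor of (2 pi)^2 is
      given away.\<close>
    have "(\<Sum>k\<in>F. (cmod (fourier_coeff f k))\<^sup>2 * (bracket k)\<^sup>2)
      \<le> (\<Sum>k\<in>F. (if k = 0 then M\<^sup>2 else 0) + (cmod (fourier_coeff f k))\<^sup>2 * (2 * pi * of_int k)\<^sup>2)"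
    proof (rule sum_mono)
      fix k
      have "(1::real) \<le> (2 * pi)\<^sup>2" using pi_gt3 by (intro one_le_power) simp
      then have "(real_of_int k)\<^sup>2 \<le> (2 * pi * of_int k)\<^sup>2"
        using mult_right_mono[of 1 "(2 * pi)\<^sup>2" "(real_of_int k)\<^sup>2"] by (simp add: power_mult_distrib)
      then show "(cmod (fourier_coeff f k))\<^sup>2 * (bracket k)\<^sup>2
          \<le> (if k = 0 then M\<^sup>2 else 0) + (cmod (fourier_coeff f k))\<^sup>2 * (2 * pi * of_int k)\<^sup>2"
        using c0 by (auto simp: bracket_def intro: mult_left_mono power_mono)
    qed
    also have "\<dots> \<le> M\<^sup>2 + B\<^sup>2"
      using diffquot[OF F] F by (simp add: sum.distrib sum.delta' add_increasing)
    also have "\<dots> \<le> (M + B)\<^sup>2"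
      using M0 B by (simp add: power2_sum)
    finally show ?thesis
      using M0 B unfolding L2_set_def power_mult_distrib by (intro real_le_lsqrt sum_nonneg) auto
  qed
  note w = weighted_l2I[OF this]
  show "f \<in> H1" using w(1) cont per by (simp add: H1_def weighted_l2_def)
  show "norm_H1 f \<le> M + B" using w(2) by (simp add: norm_H1_weighted_l2_norm)
qed

lemma weighted_l2_norm_nonneg: "0 \<le> weighted_l2_norm a"
  unfolding weighted_l2_norm_def by (auto intro!: infsum_nonneg)

lemma norm_H1_nonneg: "0 \<le> norm_H1 f"
  by (simp add: norm_H1_weighted_l2_norm weighted_l2_norm_nonneg)

text \<open>The Cauchy-Schwarz constant that bounds the sum of the moduli of the coefficients by
  \<open>norm_H1\<close>, and thereby the norm of the embedding of \<open>H1\<close> into the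
  bounded functions.\<close>

definition sup_const :: real where
  "sup_const = sqrt (\<Sum>\<^sub>\<infinity>k. 1 / (bracket k)\<^sup>2)"

lemma sup_const_nonneg: "0 \<le> sup_const"
  unfolding sup_const_def by (auto intro!: infsum_nonneg)

lemma norm_le_norm_H1:
  assumes "f \<in> H1"
  shows "cmod (f y) \<le> sup_const * norm_H1 f"
proof -
  let ?a = "fourier_coeff f"
  note w = H1_weighted_l2[OF assms]
  have "(\<Sum>k\<in>F. cmod (?a k)) \<le> sup_const * norm_H1 f" if "finite F" for F
  proof -
    have b: "bracket k \<noteq> 0" for k using bracket_ge_1[of k] by auto
    have "(\<Sum>k\<in>F. cmod (?a k)) = (\<Sum>k\<in>F. \<bar>1 / bracket k\<bar> * \<bar>cmod (?a k) * bracket k\<bar>)"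
      using b by (intro sum.cong refl) (simp add: abs_mult)
    also have "\<dots> \<le> L2_set (\<lambda>k. 1 / bracket k) F * L2_set (\<lambda>k. cmod (?a k) * bracket k) F"
      by (rule L2_set_mult_ineq)
    also have "\<dots> \<le> sup_const * weighted_l2_norm ?a"
    proof (intro mult_mono L2_set_le_weighted_l2_norm w that)
      show "L2_set (\<lambda>k. 1 / bracket k) F \<le> sup_const"
        unfolding L2_set_def sup_const_def power_divide
        using summable_bracket that by (auto intro!: finite_sum_le_infsum)
    qed (auto simp: sup_const_nonneg)
    finally show ?thesis by (simp add: norm_H1_weighted_l2_norm)
  qed
  then have "(\<Sum>\<^sub>\<infinity>k. cmod (?a k)) \<le> sup_const * norm_H1 f"
    using weighted_l2_summable[OF w] by (intro infsum_le_finite_sums) auto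
  moreover have "cmod (f y) \<le> (\<Sum>\<^sub>\<infinity>k. cmod (?a k))"
    using weighted_l2_summable[OF w]
    by (intro norm_infsum_le[OF H1_fourier_series[OF assms]]) (auto simp: norm_mult)
  ultimately show ?thesis by simp
qed

lemma H1_translate:
  assumes f: "f \<in> H1" and h: "0 \<le> h" "h \<le> 1"
  shows "(\<lambda>y. f (y + h)) \<in> H1"
proof -
  note c = H1_cont[OF f]
  have "continuous_on UNIV (\<lambda>y. f (y + h))"
    by (intro continuous_on_compose2[OF c] continuous_intros) auto
  moreover have "f (y + 1 + h) = f (y + h)" for y
    using H1_periodic[OF f, of "y + h"] by (simp add: add_ac)
  moreover have "cmod (fourier_coeff (\<lambda>y. f (y + h)) k) = cmod (fourier_coeff f k)" for k
    using h by (simp add: fc_translate[OF c H1_periodic[OF f]] norm_mult)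
  ultimately show ?thesis using f by (simp add: H1_def)
qed

text \<open>The converse of \<open>H1I_translation\<close>, with \<open>B\<close> equal to 2 pi
  times the norm. By Parseval it reduces to the bound |exp(it) - 1| <= |t| at each
  frequency.\<close>

lemma H1_translation_bound:
  assumes f: "f \<in> H1" and h: "0 < h" "h \<le> 1"
  shows "integral {0..1} (\<lambda>y. (cmod (f (y + h) - f y))\<^sup>2) \<le> (2 * pi * norm_H1 f * h)\<^sup>2"
proof -
  let ?g = "\<lambda>y. f (y + h) + (-1) * f y"
  have g: "?g \<in> H1" using f h by (intro H1_add H1_translate H1_scale) auto
  have fc: "fourier_coeff ?g k = (cis (2 * pi * of_int k * h) - 1) * fourier_coeff f k" for k
    using H1_cont[OF f] H1_cont[OF H1_translate[OF f, of h]] H1_periodic[OF f] h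
    by (simp add: fc_diff fc_translate algebra_simps)
  have b: "(cmod (fourier_coeff ?g k))\<^sup>2 \<le> (2 * pi * h)\<^sup>2 * ((cmod (fourier_coeff f k))\<^sup>2 * (bracket k)\<^sup>2)" for k
  proof -
    have "cmod (cis (2 * pi * of_int k * h) - 1) \<le> \<bar>2 * pi * of_int k * h\<bar>"
      using dist_exp_i_1[of "2 * pi * of_int k * h"] abs_sin_x_le_abs_x[of "2 * pi * of_int k * h / 2"]
      by (simp add: cis_conv_exp)
    also have "\<dots> \<le> 2 * pi * h * bracket k"
      using h by (simp add: bracket_def abs_mult)
    finally have "cmod (fourier_coeff ?g k) \<le> (2 * pi * h * bracket k) * cmod (fourier_coeff f k)"
      unfolding fc norm_mult by (rule mult_right_mono) simp
    from power_mono[OF this norm_ge_zero, of 2] show ?thesis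
      by (simp add: power_mult_distrib mult_ac)
  qed
  have "integral {0..1} (\<lambda>y. (cmod (?g y))\<^sup>2) \<le> (2 * pi * h)\<^sup>2 * (\<Sum>\<^sub>\<infinity>k. (cmod (fourier_coeff f k))\<^sup>2 * (bracket k)\<^sup>2)"
    using H1_weighted_l2[OF f]
    by (intro has_sum_mono[OF Parseval[OF g] has_sum_cmult_right[OF has_sum_infsum]] b)
       (simp add: weighted_l2_def)
  also have "\<dots> = (2 * pi * norm_H1 f * h)\<^sup>2"
    by (simp add: norm_H1_def power_mult_distrib infsum_nonneg)
  finally show ?thesis by simp
qed

text \<open>The summands come from the sup bound and the translation bound of a product. In the
  second, 4 pi is the 2 pi of \<open>H1_translation_bound\<close> doubled: (a + b)^2 <= 2 a^2 + 2
  b^2 is used, and the two resulting terms have equal bounds.\<close>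

definition mult_const :: real where
  "mult_const = sup_const * sup_const + 4 * pi * sup_const"

text \<open>The increment of the product is split as in the product rule. Each term then has one
  factor bounded in the sup norm and one increment estimated in L2.\<close>

lemma H1_mult:
  assumes f: "f \<in> H1" and g: "g \<in> H1"
  shows "(\<lambda>y. f y * g y) \<in> H1" "norm_H1 (\<lambda>y. f y * g y) \<le> mult_const * norm_H1 f * norm_H1 g"
proof -
  let ?F = "sup_const * norm_H1 f" and ?G = "sup_const * norm_H1 g"
  note nn = norm_H1_nonneg[of f] norm_H1_nonneg[of g] sup_const_nonneg
  have cont: "continuous_on UNIV (\<lambda>y. f y * g y)"
    by (intro continuous_intros H1_cont f g)
  have per: "f (y + 1) * g (y + 1) = f y * g y" for y
    by (simp add: H1_periodic f g)
  have sup: "cmod (f y * g y) \<le> ?F * ?G" for y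
    unfolding norm_mult using nn by (intro mult_mono norm_le_norm_H1 f g) auto
  have trans: "integral {0..1} (\<lambda>y. (cmod (f (y + h) * g (y + h) - f y * g y))\<^sup>2)
      \<le> (4 * pi * sup_const * norm_H1 f * norm_H1 g * h)\<^sup>2" if h: "0 < h" "h \<le> 1" for h
  proof -
    let ?df = "\<lambda>y. (cmod (f (y + h) - f y))\<^sup>2" and ?dg = "\<lambda>y. (cmod (g (y + h) - g y))\<^sup>2"
    have c: "continuous_on {0..1} f" "continuous_on {0..1} g"
        "continuous_on {0..1} (\<lambda>y. f (y + h))" "continuous_on {0..1} (\<lambda>y. g (y + h))"
      by (intro continuous_on_compose2[OF H1_cont[OF f]] continuous_on_compose2[OF H1_cont[OF g]]
           continuous_intros subset_UNIV)+
    have ptw: "(cmod (f (y + h) * g (y + h) - f y * g y))\<^sup>2 \<le> 2 * ?G\<^sup>2 * ?df y + 2 * ?F\<^sup>2 * ?dg y" for y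
    proof -
      have "f (y + h) * g (y + h) - f y * g y = (f (y + h) - f y) * g (y + h) + f y * (g (y + h) - g y)"
        by (simp add: algebra_simps)
      also have "cmod \<dots> \<le> ?G * cmod (f (y + h) - f y) + ?F * cmod (g (y + h) - g y)"
        using norm_le_norm_H1[OF f, of y] norm_le_norm_H1[OF g, of "y + h"]
        by (intro norm_triangle_le add_mono)
           (simp_all add: norm_mult mult.commute[of "cmod (f (y + h) - f y)"] mult_right_mono)
      finally have "(cmod (f (y + h) * g (y + h) - f y * g y))\<^sup>2
          \<le> (?G * cmod (f (y + h) - f y) + ?F * cmod (g (y + h) - g y))\<^sup>2"
        by (intro power_mono) auto
      also have "\<dots> \<le> 2 * (?G * cmod (f (y + h) - f y))\<^sup>2 + 2 * (?F * cmod (g (y + h) - g y))\<^sup>2"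
        using sum_squares_bound[of "?G * cmod (f (y + h) - f y)" "?F * cmod (g (y + h) - g y)"]
        by (simp add: power2_sum)
      finally show ?thesis by (simp add: power_mult_distrib)
    qed
    have "integral {0..1} (\<lambda>y. (cmod (f (y + h) * g (y + h) - f y * g y))\<^sup>2)
        \<le> integral {0..1} (\<lambda>y. 2 * ?G\<^sup>2 * ?df y + 2 * ?F\<^sup>2 * ?dg y)"
      by (intro integral_le ptw integrable_continuous_interval continuous_intros c)
    also have "\<dots> = 2 * ?G\<^sup>2 * integral {0..1} ?df + 2 * ?F\<^sup>2 * integral {0..1} ?dg"
      by (subst integral_add) (auto intro!: integrable_continuous_interval continuous_intros c)
    also have "\<dots> \<le> 2 * ?G\<^sup>2 * (2 * pi * norm_H1 f * h)\<^sup>2 + 2 * ?F\<^sup>2 * (2 * pi * norm_H1 g * h)\<^sup>2"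
      by (intro add_mono mult_left_mono H1_translation_bound f g h) auto
    also have "\<dots> = (4 * pi * sup_const * norm_H1 f * norm_H1 g * h)\<^sup>2"
      by (simp add: power_mult_distrib)
    finally show ?thesis .
  qed
  have "0 \<le> 4 * pi * sup_const * norm_H1 f * norm_H1 g" using nn by simp
  note H = H1I_translation[OF cont per sup this trans]
  show "(\<lambda>y. f y * g y) \<in> H1" by (rule H(1))
  have "?F * ?G + 4 * pi * sup_const * norm_H1 f * norm_H1 g = mult_const * norm_H1 f * norm_H1 g"
    by (simp add: mult_const_def algebra_simps)
  then show "norm_H1 (\<lambda>y. f y * g y) \<le> mult_const * norm_H1 f * norm_H1 g"
    using H(2) by simp
qed

lemma H1_nonvanishing_lower_bound:
  assumes f: "f \<in> H1" and nz: "\<And>y. f y \<noteq> 0"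
  obtains m where "m > 0" "\<And>y. m \<le> cmod (f y)"
proof -
  have "continuous_on {0..1} (\<lambda>y. cmod (f y))"
    using H1_cont[OF f] continuous_on_subset by (intro continuous_on_norm) blast
  then obtain x where x: "x \<in> {0..1}" "\<And>y. y \<in> {0..1} \<Longrightarrow> cmod (f x) \<le> cmod (f y)"
    using continuous_attains_inf[of "{0..1::real}" "\<lambda>y. cmod (f y)"] by auto
  have "cmod (f x) \<le> cmod (f y)" for y
  proof -
    have "f (frac y + of_int \<lfloor>y\<rfloor>) = f (frac y)"
      by (rule periodic_int) (rule H1_periodic[OF f])
    then have "f y = f (frac y)" by (simp add: frac_def)
    then show ?thesis using x(2)[of "frac y"] frac_lt_1[of y] by simp
  qed
  then show ?thesis using nz[of x] that[of "cmod (f x)"] by simp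
qed

text \<open>A positive lower bound \<open>m\<close> of |f| bounds an increment of 1/f by the
  increment of \<open>f\<close> divided by \<open>m^2\<close>. Membership alone is enough later on,
  since the Neumann series supplies its own estimates.\<close>

lemma H1_inverse:
  assumes f: "f \<in> H1" and nz: "\<And>y. f y \<noteq> 0"
  shows "(\<lambda>y. inverse (f y)) \<in> H1"
proof -
  obtain m where m: "m > 0" "\<And>y. m \<le> cmod (f y)"
    using H1_nonvanishing_lower_bound[OF f nz] by blast
  have cont: "continuous_on UNIV (\<lambda>y. inverse (f y))"
    using nz by (intro continuous_on_inverse H1_cont f) auto
  have per: "inverse (f (y + 1)) = inverse (f y)" for y
    by (simp add: H1_periodic f)
  have sup: "cmod (inverse (f y)) \<le> inverse m" for y
    using m by (simp add: norm_inverse le_imp_inverse_le)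
  have trans: "integral {0..1} (\<lambda>y. (cmod (inverse (f (y + h)) - inverse (f y)))\<^sup>2)
      \<le> (2 * pi * norm_H1 f / m\<^sup>2 * h)\<^sup>2" if h: "0 < h" "h \<le> 1" for h
  proof -
    have c: "continuous_on {0..1} f" "continuous_on {0..1} (\<lambda>y. f (y + h))"
      by (intro continuous_on_compose2[OF H1_cont[OF f]] continuous_intros subset_UNIV)+
    have ptw: "(cmod (inverse (f (y + h)) - inverse (f y)))\<^sup>2 \<le> (inverse (m\<^sup>2))\<^sup>2 * (cmod (f (y + h) - f y))\<^sup>2" for y
    proof -
      have "inverse (f (y + h)) - inverse (f y) = inverse (f (y + h)) * (f y - f (y + h)) * inverse (f y)"
        using nz by (simp add: inverse_diff_inverse algebra_simps)
      also have "cmod \<dots> = (cmod (inverse (f (y + h))) * cmod (inverse (f y))) * cmod (f (y + h) - f y)"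
        by (simp add: norm_mult norm_minus_commute)
      also have "\<dots> \<le> (inverse m * inverse m) * cmod (f (y + h) - f y)"
        using m(1) by (intro mult_right_mono mult_mono sup) auto
      finally have "(cmod (inverse (f (y + h)) - inverse (f y)))\<^sup>2
          \<le> ((inverse m * inverse m) * cmod (f (y + h) - f y))\<^sup>2"
        by (intro power_mono) auto
      then show ?thesis
        unfolding power_mult_distrib by (simp add: power2_eq_square)
    qed
    have "integral {0..1} (\<lambda>y. (cmod (inverse (f (y + h)) - inverse (f y)))\<^sup>2)
        \<le> integral {0..1} (\<lambda>y. (inverse (m\<^sup>2))\<^sup>2 * (cmod (f (y + h) - f y))\<^sup>2)"
      using nz by (intro integral_le ptw integrable_continuous_interval continuous_intros c) auto
    also have "\<dots> \<le> (inverse (m\<^sup>2))\<^sup>2 * (2 * pi * norm_H1 f * h)\<^sup>2"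
      using H1_translation_bound[OF f h] by (simp add: mult_left_mono)
    also have "\<dots> = (2 * pi * norm_H1 f / m\<^sup>2 * h)\<^sup>2"
      by (simp add: power_mult_distrib power_divide divide_inverse power_inverse)
    finally show ?thesis .
  qed
  show ?thesis
    by (rule H1I_translation(1)[OF cont per sup _ trans]) (use norm_H1_nonneg m in auto)
qed

section \<open>Locally normally convergent power series\<close>

lemma scaleC_zero_right [simp]: "c *\<^sub>C (0 :: 'a::complex_normed_vector) = 0"
  using scaleC_add_right[of c "0 :: 'a" 0] by simp

lemma scaleC_minus_right: "c *\<^sub>C (- x) = - (c *\<^sub>C (x :: 'a::complex_normed_vector))"
  using scaleC_add_right[of c x "- x"] by (simp add: eq_neg_iff_add_eq_0 add.commute)

definition bounded_clinear :: "('a::complex_normed_vector \<Rightarrow> 'b::complex_normed_vector) \<Rightarrow> bool" where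
  "bounded_clinear L \<longleftrightarrow> bounded_linear L \<and> (\<forall>c x. L (c *\<^sub>C x) = c *\<^sub>C L x)"

definition bounded_cbilinear ::
  "('a::complex_normed_vector \<Rightarrow> 'b::complex_normed_vector \<Rightarrow> 'c::complex_normed_vector) \<Rightarrow> bool" where
  "bounded_cbilinear B \<longleftrightarrow> bounded_bilinear B \<and>
     (\<forall>c x y. B (c *\<^sub>C x) y = c *\<^sub>C B x y \<and> B x (c *\<^sub>C y) = c *\<^sub>C B x y)"

lemma bounded_clinearI:
  assumes "\<And>x y. L (x + y) = L x + L y" "\<And>c x. L (c *\<^sub>C x) = c *\<^sub>C L x"
    and "\<And>x. norm (L x) \<le> norm x * K"
  shows "bounded_clinear L"
  unfolding bounded_clinear_def
  using assms by (auto intro!: bounded_linear_intro[where K=K] simp flip: scaleC_of_real)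

lemma bounded_cbilinearI:
  assumes "\<And>x x' y. B (x + x') y = B x y + B x' y" "\<And>x y y'. B x (y + y') = B x y + B x y'"
    and "\<And>c x y. B (c *\<^sub>C x) y = c *\<^sub>C B x y" "\<And>c x y. B x (c *\<^sub>C y) = c *\<^sub>C B x y"
    and "\<And>x y. norm (B x y) \<le> norm x * norm y * K"
  shows "bounded_cbilinear B"
  unfolding bounded_cbilinear_def
proof (intro conjI allI)
  show "bounded_bilinear B"
    by standard (use assms in \<open>auto simp flip: scaleC_of_real\<close>)
qed (use assms in auto)

lemma bounded_clinear_compose:
  "bounded_clinear L \<Longrightarrow> bounded_clinear M \<Longrightarrow> bounded_clinear (\<lambda>x. L (M x))"
  unfolding bounded_clinear_def by (auto intro: bounded_linear_compose)

lemma bounded_clinear_fst: "bounded_clinear fst"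
  and bounded_clinear_snd: "bounded_clinear snd"
  by (simp_all add: bounded_clinear_def bounded_linear_fst bounded_linear_snd scaleC_prod_def)

lemma bounded_clinear_uminus: "bounded_clinear uminus"
  by (simp add: bounded_clinear_def scaleC_minus_right bounded_linear_minus bounded_linear_ident)

lemma bounded_cbilinear_compose:
  assumes "bounded_cbilinear B" "bounded_clinear L"
  shows "bounded_cbilinear (\<lambda>x. B (L x))"
proof -
  interpret B: bounded_bilinear B using assms(1) by (simp add: bounded_cbilinear_def)
  show ?thesis
    using B.comp[of L "\<lambda>y. y"] assms
    by (simp add: bounded_clinear_def bounded_cbilinear_def bounded_linear_ident)
qed

text \<open>The conditions of \<open>bounded_multilinear\<close> with the constant exposed, so that
  the constants of all degrees can enter one majorant series.\<close>

definition multilinear_bound ::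
  "nat \<Rightarrow> ('a::complex_normed_vector list \<Rightarrow> 'b::complex_normed_vector) \<Rightarrow> real \<Rightarrow> bool" where
  "multilinear_bound n A K \<longleftrightarrow>
     (\<forall>xs i x y. length xs = n \<longrightarrow> i < n \<longrightarrow> A (xs[i := x + y]) = A (xs[i := x]) + A (xs[i := y])) \<and>
     (\<forall>xs i c x. length xs = n \<longrightarrow> i < n \<longrightarrow> A (xs[i := c *\<^sub>C x]) = c *\<^sub>C A (xs[i := x])) \<and>
     (\<forall>xs. length xs = n \<longrightarrow> norm (A xs) \<le> K * (\<Prod>x\<leftarrow>xs. norm x))"

lemma multilinear_bound_bounded: "multilinear_bound n A K \<Longrightarrow> bounded_multilinear n A"
  unfolding multilinear_bound_def bounded_multilinear_def by blast

lemma multilinear_bound_replicate: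
  "multilinear_bound n A K \<Longrightarrow> norm (A (replicate n h)) \<le> K * norm h ^ n"
  unfolding multilinear_bound_def by (metis length_replicate map_replicate prod_list_replicate)

lemma multilinear_bound_cong:
  assumes "multilinear_bound n A K" "\<And>xs. length xs = n \<Longrightarrow> A xs = B xs"
  shows "multilinear_bound n B K"
  using assms unfolding multilinear_bound_def by auto

lemma multilinear_bound_add:
  assumes "multilinear_bound n A K" "multilinear_bound n B M"
  shows "multilinear_bound n (\<lambda>xs. A xs + B xs) (K + M)"
  using assms unfolding multilinear_bound_def
  by (auto simp: scaleC_add_right distrib_right intro!: norm_triangle_le add_mono)

lemma multilinear_bound_zero: "multilinear_bound n (\<lambda>xs. 0) 0"
  unfolding multilinear_bound_def by simp

lemma multilinear_bound_sum:
  assumes "finite I" "\<And>i. i \<in> I \<Longrightarrow> multilinear_bound n (A i) (K i)"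
  shows "multilinear_bound n (\<lambda>xs. \<Sum>i\<in>I. A i xs) (\<Sum>i\<in>I. K i)"
  using assms by (induction I) (auto intro: multilinear_bound_zero multilinear_bound_add)

lemma multilinear_bound_const: "multilinear_bound 0 (\<lambda>xs. c) (norm c)"
  unfolding multilinear_bound_def by simp

lemma multilinear_bound_hd: "multilinear_bound 1 hd 1"
  unfolding multilinear_bound_def by (auto simp: length_Suc_conv)

lemma multilinear_bound_linear:
  assumes "multilinear_bound n A K" "bounded_clinear L" "\<And>x. norm (L x) \<le> M * norm x" "0 \<le> M"
  shows "multilinear_bound n (\<lambda>xs. L (A xs)) (M * K)"
proof -
  interpret L: bounded_linear L using assms(2) by (simp add: bounded_clinear_def)
  have "norm (L (A xs)) \<le> M * K * (\<Prod>x\<leftarrow>xs. norm x)" if "length xs = n" for xs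
  proof -
    have "norm (A xs) \<le> K * (\<Prod>x\<leftarrow>xs. norm x)"
      using assms(1) that by (simp add: multilinear_bound_def)
    from order_trans[OF assms(3) mult_left_mono[OF this assms(4)]] show ?thesis
      by (simp add: mult.assoc)
  qed
  then show ?thesis
    using assms(1,2) by (simp add: multilinear_bound_def bounded_clinear_def L.add)
qed

lemma prod_list_norm_nonneg: "0 \<le> (\<Prod>x\<leftarrow>xs. norm x)"
  by (induction xs) auto

text \<open>The argument list is cut in two, one piece for each factor. As
  \<open>bounded_multilinear\<close> asks for no symmetry, nothing has to be symmetrized.\<close>

lemma multilinear_bound_bilinear:
  assumes A: "multilinear_bound i A K" and A': "multilinear_bound j A' K'"
    and B: "bounded_cbilinear B" and M: "\<And>x y. norm (B x y) \<le> M * norm x * norm y" "0 \<le> M"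
    and K: "0 \<le> K"
  shows "multilinear_bound (i + j) (\<lambda>xs. B (A (take i xs)) (A' (drop i xs))) (M * K * K')"
proof -
  interpret B: bounded_bilinear B using B by (simp add: bounded_cbilinear_def)
  have "norm (B (A (take i xs)) (A' (drop i xs))) \<le> M * K * K' * (\<Prod>x\<leftarrow>xs. norm x)"
    if "length xs = i + j" for xs
  proof -
    let ?P = "\<Prod>x\<leftarrow>take i xs. norm x" and ?Q = "\<Prod>x\<leftarrow>drop i xs. norm x"
    have PQ: "(\<Prod>x\<leftarrow>xs. norm x) = ?P * ?Q"
      by (metis append_take_drop_id map_append prod_list.append)
    have "norm (B (A (take i xs)) (A' (drop i xs))) \<le> M * norm (A (take i xs)) * norm (A' (drop i xs))"
      by (rule M)
    also have "\<dots> \<le> M * (K * ?P) * (K' * ?Q)"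
      using A A' that M(2) K prod_list_norm_nonneg[of "take i xs"]
      by (intro mult_mono mult_left_mono) (auto simp: multilinear_bound_def)
    finally show ?thesis by (simp add: PQ mult_ac)
  qed
  \<comment> \<open>Changing one entry of the list affects exactly one of the two pieces, so
    linearity in that entry is inherited from the corresponding factor.\<close>
  moreover have "take i (xs[k := x]) = (take i xs)[k := x] \<and> drop i (xs[k := x]) = drop i xs"
    if "k < i" for xs :: "'a list" and k x
    using that by (simp add: take_update_swap)
  moreover have "take i (xs[k := x]) = take i xs \<and> drop i (xs[k := x]) = (drop i xs)[k - i := x]"
    if "\<not> k < i" for xs :: "'a list" and k x
    using that by (simp add: drop_update_swap)
  ultimately show ?thesis
    using A A' B unfolding multilinear_bound_def bounded_cbilinear_def
    by (intro conjI allI impI; (case_tac "ia < i")?) (simp_all add: B.add_left B.add_right)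
qed

text \<open>Normal convergence on the ball of radius \<open>r\<close>. The values at
  \<open>x + h\<close> are prescribed as sums, so convergence never has to be derived from
  completeness in the closure lemmas.\<close>

definition power_series_at :: "('a::complex_normed_vector \<Rightarrow> 'b::complex_normed_vector) \<Rightarrow> 'a \<Rightarrow> bool" where
  "power_series_at F x \<longleftrightarrow> (\<exists>r>0. \<exists>A K. (\<forall>n. multilinear_bound n (A n) (K n) \<and> 0 \<le> K n) \<and>
     summable (\<lambda>n. K n * r ^ n) \<and> (\<forall>h. norm h < r \<longrightarrow> (\<lambda>n. A n (replicate n h)) sums F (x + h)))"

lemma multilinear_bound_abs_summable:
  assumes "\<And>n. multilinear_bound n (A n) (K n)" "\<And>n. 0 \<le> K n" "summable (\<lambda>n. K n * r ^ n)" "norm h < r"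
  shows "summable (\<lambda>n. norm (A n (replicate n h)))"
proof (rule summable_comparison_test'[OF assms(3), of 0])
  fix n
  have "norm (A n (replicate n h)) \<le> K n * norm h ^ n"
    by (rule multilinear_bound_replicate[OF assms(1)])
  also have "\<dots> \<le> K n * r ^ n"
    using assms by (intro mult_left_mono power_mono) auto
  finally show "norm (norm (A n (replicate n h))) \<le> K n * r ^ n" by simp
qed

lemma power_series_atI:
  assumes "r > 0" "\<And>n. multilinear_bound n (A n) (K n)" "\<And>n. 0 \<le> K n" "summable (\<lambda>n. K n * r ^ n)"
    and "\<And>h. norm h < r \<Longrightarrow> (\<lambda>n. A n (replicate n h)) sums F (x + h)"
  shows "power_series_at F x"
  unfolding power_series_at_def using assms by blast

lemma power_series_atE:
  assumes "power_series_at F x" "e > 0"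
  obtains r A K where "r > 0" "r \<le> e" "\<And>n. multilinear_bound n (A n) (K n)" "\<And>n. 0 \<le> K n"
    "summable (\<lambda>n. K n * r ^ n)" "\<And>h. norm h < r \<Longrightarrow> (\<lambda>n. A n (replicate n h)) sums F (x + h)"
proof -
  obtain r A K where r: "r > 0" and A: "\<And>n. multilinear_bound n (A n) (K n)" and K: "\<And>n. 0 \<le> K n"
    and s: "summable (\<lambda>n. K n * r ^ n)" "\<And>h. norm h < r \<Longrightarrow> (\<lambda>n. A n (replicate n h)) sums F (x + h)"
    using assms(1) unfolding power_series_at_def by blast
  have "summable (\<lambda>n. K n * min r e ^ n)"
    using r K assms(2)
    by (intro summable_comparison_test[OF _ s(1)] exI[of _ 0]) (auto intro!: mult_left_mono power_mono)
  then show ?thesis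
    using that[of "min r e" A K] r assms(2) A K s by simp
qed

lemma power_series_at_two:
  assumes "power_series_at F x" "power_series_at G x"
  obtains r A K B M where "r > 0"
    "\<And>n. multilinear_bound n (A n) (K n)" "\<And>n. 0 \<le> K n" "summable (\<lambda>n. K n * r ^ n)"
    "\<And>h. norm h < r \<Longrightarrow> (\<lambda>n. A n (replicate n h)) sums F (x + h)"
    "\<And>n. multilinear_bound n (B n) (M n)" "\<And>n. 0 \<le> M n" "summable (\<lambda>n. M n * r ^ n)"
    "\<And>h. norm h < r \<Longrightarrow> (\<lambda>n. B n (replicate n h)) sums G (x + h)"
proof -
  obtain r A K where A: "r > 0" "r \<le> 1" "\<And>n. multilinear_bound n (A n) (K n)" "\<And>n. 0 \<le> K n"
    "summable (\<lambda>n. K n * r ^ n)" "\<And>h. norm h < r \<Longrightarrow> (\<lambda>n. A n (replicate n h)) sums F (x + h)"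
    by (rule power_series_atE[OF assms(1) zero_less_one]) (rule that, assumption+)
  obtain s B M where B: "s > 0" "s \<le> r" "\<And>n. multilinear_bound n (B n) (M n)" "\<And>n. 0 \<le> M n"
    "summable (\<lambda>n. M n * s ^ n)" "\<And>h. norm h < s \<Longrightarrow> (\<lambda>n. B n (replicate n h)) sums G (x + h)"
    by (rule power_series_atE[OF assms(2) A(1)]) (rule that, assumption+)
  have "summable (\<lambda>n. K n * s ^ n)"
    using A B by (intro summable_comparison_test[OF _ A(5)] exI[of _ 0]) (auto intro!: mult_left_mono power_mono)
  then show ?thesis
    using that[of s A K B M] A B by simp
qed

text \<open>Only the germ at \<open>x\<close> matters. This transfers the result from the explicit
  formula \<open>momentum\<close> to \<open>momentum_map\<close>, with which it is only shown to
  agree on an open set.\<close>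

lemma power_series_at_cong:
  assumes "power_series_at F x" "open U" "x \<in> U" "\<And>y. y \<in> U \<Longrightarrow> F y = G y"
  shows "power_series_at G x"
proof -
  obtain e where e: "e > 0" "ball x e \<subseteq> U"
    using assms(2,3) open_contains_ball by blast
  obtain r A K where A: "r > 0" "r \<le> e" "\<And>n. multilinear_bound n (A n) (K n)" "\<And>n. 0 \<le> K n"
    "summable (\<lambda>n. K n * r ^ n)" "\<And>h. norm h < r \<Longrightarrow> (\<lambda>n. A n (replicate n h)) sums F (x + h)"
    by (rule power_series_atE[OF assms(1) e(1)]) (rule that, assumption+)
  have "F (x + h) = G (x + h)" if "norm h < r" for h
    using that A(2) e(2) by (intro assms(4)) (auto simp: dist_norm)
  then show ?thesis
    using A by (intro power_series_atI[of r A K]) auto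
qed

lemma power_series_at_const: "power_series_at (\<lambda>_. c) x"
proof (rule power_series_atI)
  show "multilinear_bound n (\<lambda>_. if n = 0 then c else 0) (if n = 0 then norm c else 0)" for n
    by (simp add: multilinear_bound_const multilinear_bound_zero)
  show "summable (\<lambda>n. (if n = 0 then norm c else 0) * 1 ^ n)"
    by (rule summable_finite[of "{0}"]) auto
  show "(\<lambda>n. if n = 0 then c else 0) sums c"
    using sums_If_finite[of "\<lambda>n. n = 0" "\<lambda>_. c"] by simp
qed auto

lemma power_series_at_add:
  assumes "power_series_at F x" "power_series_at G x"
  shows "power_series_at (\<lambda>y. F y + G y) x"
proof -
  obtain r A K B M where r: "r > 0" and
    A: "\<And>n. multilinear_bound n (A n) (K n)" "\<And>n. 0 \<le> K n" "summable (\<lambda>n. K n * r ^ n)"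
      "\<And>h. norm h < r \<Longrightarrow> (\<lambda>n. A n (replicate n h)) sums F (x + h)" and
    B: "\<And>n. multilinear_bound n (B n) (M n)" "\<And>n. 0 \<le> M n" "summable (\<lambda>n. M n * r ^ n)"
      "\<And>h. norm h < r \<Longrightarrow> (\<lambda>n. B n (replicate n h)) sums G (x + h)"
    by (rule power_series_at_two[OF assms]) (rule that, assumption+)
  show ?thesis
  proof (rule power_series_atI[OF r multilinear_bound_add[OF A(1) B(1)]])
    show "summable (\<lambda>n. (K n + M n) * r ^ n)"
      unfolding distrib_right by (intro summable_add A B)
  qed (use A B in \<open>auto intro: sums_add\<close>)
qed

lemma power_series_at_linear:
  assumes "power_series_at F x" "bounded_clinear L"
  shows "power_series_at (\<lambda>y. L (F y)) x"
proof -
  interpret L: bounded_linear L using assms(2) by (simp add: bounded_clinear_def)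
  obtain M where M: "0 \<le> M" "\<And>x. norm (L x) \<le> M * norm x"
    using L.nonneg_bounded by (metis mult.commute)
  obtain r A K where A: "r > 0" "r \<le> 1" "\<And>n. multilinear_bound n (A n) (K n)" "\<And>n. 0 \<le> K n"
    "summable (\<lambda>n. K n * r ^ n)" "\<And>h. norm h < r \<Longrightarrow> (\<lambda>n. A n (replicate n h)) sums F (x + h)"
    by (rule power_series_atE[OF assms(1) zero_less_one]) (rule that, assumption+)
  show ?thesis
  proof (rule power_series_atI[OF A(1) multilinear_bound_linear[OF A(3) assms(2) M(2,1)]])
    show "summable (\<lambda>n. M * K n * r ^ n)"
      unfolding mult.assoc by (intro summable_mult A)
  qed (use A M L.sums in auto)
qed

text \<open>The product of partial sums runs over a square of indices, the Cauchy product over a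
  triangle inside it. The terms in between are dominated by the same square-minus-triangle
  difference \<open>?d\<close> for the norms, which tends to 0 by the scalar Cauchy product
  theorem.\<close>

lemma bilinear_Cauchy_product_sums:
  fixes B :: "'a::real_normed_vector \<Rightarrow> 'b::real_normed_vector \<Rightarrow> 'c::real_normed_vector"
  assumes B: "bounded_bilinear B" and a: "a sums s" "summable (\<lambda>n. norm (a n))"
    and b: "b sums t" "summable (\<lambda>n. norm (b n))"
  shows "(\<lambda>n. \<Sum>i\<le>n. B (a i) (b (n - i))) sums B s t"
proof -
  interpret B: bounded_bilinear B by (rule B)
  obtain M where M: "M > 0" "\<And>x y. norm (B x y) \<le> norm x * norm y * M"
    using B.pos_bounded by blast
  let ?sq = "\<lambda>N :: nat. {..<N} \<times> {..<N}" and ?tr = "\<lambda>N :: nat. {(i, j). i + j < N}"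
  let ?a = "\<lambda>n. norm (a n)" and ?b = "\<lambda>n. norm (b n)"
  let ?d = "\<lambda>N. (\<Sum>i<N. ?a i) * (\<Sum>j<N. ?b j) - (\<Sum>n<N. \<Sum>i\<le>n. ?a i * ?b (n - i))"
  have sub: "?tr N \<subseteq> ?sq N" for N by auto
  have P: "(\<lambda>N. B (\<Sum>i<N. a i) (\<Sum>j<N. b j)) \<longlonglongrightarrow> B s t"
    using a b by (intro B.tendsto) (auto simp: sums_def)
  have d: "?d \<longlonglongrightarrow> 0"
  proof -
    have "?d \<longlonglongrightarrow> suminf ?a * suminf ?b - suminf ?a * suminf ?b"
      using a b Cauchy_product_sums[of ?a ?b]
      by (intro tendsto_diff tendsto_mult summable_LIMSEQ) (auto simp: sums_def)
    then show ?thesis by simp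
  qed
  have bound: "norm (B (\<Sum>i<N. a i) (\<Sum>j<N. b j) - (\<Sum>n<N. \<Sum>i\<le>n. B (a i) (b (n - i)))) \<le> ?d N * M" for N
  proof -
    have "B (\<Sum>i<N. a i) (\<Sum>j<N. b j) - (\<Sum>n<N. \<Sum>i\<le>n. B (a i) (b (n - i)))
        = (\<Sum>(i, j)\<in>?sq N. B (a i) (b j)) - (\<Sum>(i, j)\<in>?tr N. B (a i) (b j))"
      by (subst B.sum_left) (simp add: B.sum_right sum.cartesian_product sum.triangle_reindex)
    also have "\<dots> = (\<Sum>(i, j)\<in>?sq N - ?tr N. B (a i) (b j))"
      by (rule sum_diff[symmetric]) (use sub in auto)
    also have "norm \<dots> \<le> (\<Sum>(i, j)\<in>?sq N - ?tr N. ?a i * ?b j * M)"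
      by (rule sum_norm_le) (auto intro: M)
    also have "\<dots> = ((\<Sum>(i, j)\<in>?sq N. ?a i * ?b j) - (\<Sum>(i, j)\<in>?tr N. ?a i * ?b j)) * M"
      using sub by (subst sum_diff[symmetric]) (auto simp: sum_distrib_right case_prod_unfold)
    also have "\<dots> = ?d N * M"
      by (simp add: sum_product sum.cartesian_product sum.triangle_reindex)
    finally show ?thesis .
  qed
  have "(\<lambda>N. B (\<Sum>i<N. a i) (\<Sum>j<N. b j) - (\<Sum>n<N. \<Sum>i\<le>n. B (a i) (b (n - i)))) \<longlonglongrightarrow> 0"
    by (rule Lim_null_comparison[OF always_eventually[OF allI[OF bound]]])
       (use tendsto_mult_right[OF d, of M] in simp)
  from tendsto_diff[OF P this] show ?thesis by (simp add: sums_def)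
qed

lemma power_series_at_bilinear:
  assumes F: "power_series_at F x" and G: "power_series_at G x" and B: "bounded_cbilinear B"
  shows "power_series_at (\<lambda>y. B (F y) (G y)) x"
proof -
  have bB: "bounded_bilinear B" using B by (simp add: bounded_cbilinear_def)
  then interpret B: bounded_bilinear B .
  obtain M where M: "0 \<le> M" "\<And>x y. norm (B x y) \<le> M * norm x * norm y"
    using B.nonneg_bounded by (metis mult.commute mult.left_commute)
  obtain r A K A' K' where r: "r > 0" and
    A: "\<And>n. multilinear_bound n (A n) (K n)" "\<And>n. 0 \<le> K n" "summable (\<lambda>n. K n * r ^ n)"
      "\<And>h. norm h < r \<Longrightarrow> (\<lambda>n. A n (replicate n h)) sums F (x + h)" and
    A': "\<And>n. multilinear_bound n (A' n) (K' n)" "\<And>n. 0 \<le> K' n" "summable (\<lambda>n. K' n * r ^ n)"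
      "\<And>h. norm h < r \<Longrightarrow> (\<lambda>n. A' n (replicate n h)) sums G (x + h)"
    by (rule power_series_at_two[OF F G]) (rule that, assumption+)
  show ?thesis
  proof (rule power_series_atI[OF r])
    \<comment> \<open>The term of degree \<open>n\<close> collects all ways to give the first
      \<open>i\<close> arguments to \<open>F\<close> and the remaining \<open>n - i\<close> to
      \<open>G\<close>.\<close>
    show "multilinear_bound n (\<lambda>xs. \<Sum>i\<le>n. B (A i (take i xs)) (A' (n - i) (drop i xs)))
        (\<Sum>i\<le>n. M * K i * K' (n - i))" for n
    proof (rule multilinear_bound_sum)
      fix i assume "i \<in> {..n}"
      then show "multilinear_bound n (\<lambda>xs. B (A i (take i xs)) (A' (n - i) (drop i xs))) (M * K i * K' (n - i))"
        using multilinear_bound_bilinear[OF A(1) A'(1) B M(2,1) A(2), of i "n - i"] by simp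
    qed simp
    show "0 \<le> (\<Sum>i\<le>n. M * K i * K' (n - i))" for n
      using A A' M by (intro sum_nonneg) auto
    \<comment> \<open>The new majorant is, up to the factor \<open>M\<close>, the Cauchy product of
      the two old ones, since the powers of \<open>r\<close> recombine.\<close>
    have "summable (\<lambda>n. M * (\<Sum>i\<le>n. (K i * r ^ i) * (K' (n - i) * r ^ (n - i))))"
      using A A' r by (intro summable_mult summable_Cauchy_product) auto
    also have "(\<lambda>n. M * (\<Sum>i\<le>n. (K i * r ^ i) * (K' (n - i) * r ^ (n - i))))
        = (\<lambda>n. (\<Sum>i\<le>n. M * K i * K' (n - i)) * r ^ n)"
    proof
      fix n
      have "r ^ i * r ^ (n - i) = r ^ n" if "i \<le> n" for i
        using that by (simp flip: power_add)
      then show "M * (\<Sum>i\<le>n. (K i * r ^ i) * (K' (n - i) * r ^ (n - i))) = (\<Sum>i\<le>n. M * K i * K' (n - i)) * r ^ n"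
        unfolding sum_distrib_left sum_distrib_right
        by (intro sum.cong refl) (simp add: mult_ac)
    qed
    finally show "summable (\<lambda>n. (\<Sum>i\<le>n. M * K i * K' (n - i)) * r ^ n)" .
    fix h :: 'a assume h: "norm h < r"
    have "(\<lambda>n. \<Sum>i\<le>n. B (A i (replicate i h)) (A' (n - i) (replicate (n - i) h))) sums B (F (x + h)) (G (x + h))"
      by (intro bilinear_Cauchy_product_sums[OF bB] A(4) A'(4) h
          multilinear_bound_abs_summable[OF A(1-3)] multilinear_bound_abs_summable[OF A'(1-3)])
    then show "(\<lambda>n. \<Sum>i\<le>n. B (A i (take i (replicate n h))) (A' (n - i) (drop i (replicate n h)))) sums B (F (x + h)) (G (x + h))"
      by (simp add: min_absorb1 cong: sum.cong_simp)
  qed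
qed

text \<open>The fixed point equation is solved by the Neumann series \<open>\<Sum>\<^sub>n B(h)\<^sup>n v\<close>.\<close>

lemma power_series_at_fixed_point:
  assumes B: "bounded_cbilinear B" and e: "e > 0"
    and eq: "\<And>h. norm h < e \<Longrightarrow> F (x + h) = v + B h (F (x + h))"
  shows "power_series_at F x"
proof -
  interpret B: bounded_bilinear B using B by (simp add: bounded_cbilinear_def)
  obtain M where M: "M > 0" "\<And>x y. norm (B x y) \<le> M * norm x * norm y"
    using B.pos_bounded by (metis mult.commute mult.left_commute)
  \<comment> \<open>The second entry makes \<open>M * r\<close> at most 1/2, so the majorant is
    geometric; the first keeps the fixed point equation available.\<close>
  define r where "r = min e (1 / (2 * M))"
  have r: "r > 0" "r \<le> e" using e M(1) by (simp_all add: r_def)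
  have Mr: "M * r \<le> 1 / 2"
    using M(1) mult_left_mono[of r "1 / (2 * M)" M] by (simp add: r_def)
  have iter_bound: "norm ((B h ^^ n) u) \<le> (M * norm h) ^ n * norm u" for h n u
  proof (induction n)
    case (Suc n)
    have "norm ((B h ^^ Suc n) u) \<le> M * norm h * norm ((B h ^^ n) u)"
      using M(2)[of h "(B h ^^ n) u"] by simp
    also have "\<dots> \<le> M * norm h * ((M * norm h) ^ n * norm u)"
      using M(1) Suc.IH by (intro mult_left_mono) auto
    finally show ?case by (simp add: mult.assoc)
  qed simp
  have iter_add: "(B h ^^ n) (u + u') = (B h ^^ n) u + (B h ^^ n) u'" for h n u u'
    by (induction n) (simp_all add: B.add_right)
  show ?thesis
  proof (rule power_series_atI[OF r(1)])
    \<comment> \<open>Nesting \<open>B\<close> along the list gives a map that is linear in every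
      entry; on a constant list it becomes the iterate of \<open>B h\<close> applied to
      \<open>v\<close>.\<close>
    show "multilinear_bound n (\<lambda>xs. foldr B xs v) (M ^ n * norm v)" for n
    proof (induction n)
      case 0
      show ?case
        using multilinear_bound_cong[OF multilinear_bound_const[of v], of "\<lambda>xs. foldr B xs v"] by simp
    next
      case (Suc n)
      have "multilinear_bound (1 + n) (\<lambda>xs. B (hd (take 1 xs)) (foldr B (drop 1 xs) v)) (M * 1 * (M ^ n * norm v))"
        using M by (intro multilinear_bound_bilinear[OF multilinear_bound_hd Suc.IH B]) auto
      then have "multilinear_bound (1 + n) (\<lambda>xs. foldr B xs v) (M * 1 * (M ^ n * norm v))"
        by (rule multilinear_bound_cong) (auto simp: length_Suc_conv)
      then show ?case by (simp add: mult.assoc)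
    qed
    show "0 \<le> M ^ n * norm v" for n using M by simp
    have "summable (\<lambda>n. norm v * (M * r) ^ n)"
      using r Mr M(1) by (intro summable_mult summable_geometric) auto
    then show "summable (\<lambda>n. M ^ n * norm v * r ^ n)"
      by (simp add: power_mult_distrib mult_ac)
    fix h :: 'a assume h: "norm h < r"
    \<comment> \<open>Applying \<open>B h ^^ N\<close> to the fixed point equation writes the
      \<open>N\<close>-th term as a difference of consecutive iterates at \<open>F (x + h)\<close>,
      so the partial sums telescope.\<close>
    have part: "(\<Sum>n<N. foldr B (replicate n h) v) = F (x + h) - (B h ^^ N) (F (x + h))" for N
    proof (induction N)
      case (Suc N)
      have "(B h ^^ N) (F (x + h)) = (B h ^^ N) (v + B h (F (x + h)))"
        using eq[of h] h r by simp
      also have "\<dots> = (B h ^^ N) v + (B h ^^ Suc N) (F (x + h))"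
        by (simp add: iter_add funpow_swap1)
      finally have "(B h ^^ N) v = (B h ^^ N) (F (x + h)) - (B h ^^ Suc N) (F (x + h))"
        by (rule eq_diff_eq[THEN iffD2, OF sym])
      then show ?case using Suc by (simp add: foldr_replicate)
    qed simp
    have "M * norm h < 1"
    proof -
      have "M * norm h \<le> M * r" using h M by (intro mult_left_mono) auto
      then show ?thesis using Mr by simp
    qed
    \<comment> \<open>For fixed \<open>h\<close> the remainder is a geometric factor times a
      constant, so only the value \<open>F (x + h)\<close> itself enters and no bound for
      \<open>F\<close> near \<open>x\<close>.\<close>
    then have "(\<lambda>N. (M * norm h) ^ N * norm (F (x + h))) \<longlonglongrightarrow> 0"
      using M by (intro tendsto_mult_left_zero LIMSEQ_realpow_zero) auto
    then have "(\<lambda>N. (B h ^^ N) (F (x + h))) \<longlonglongrightarrow> 0"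
      by (rule Lim_null_comparison[rotated]) (simp add: iter_bound)
    from tendsto_diff[OF tendsto_const[of "F (x + h)"] this]
    show "(\<lambda>n. foldr B (replicate n h) v) sums F (x + h)"
      unfolding sums_def part by simp
  qed
qed

lemma power_series_at_bounded_clinear:
  assumes "bounded_clinear L"
  shows "power_series_at L x"
proof -
  have "power_series_at (\<lambda>y. y) x"
  proof (rule power_series_atI)
    let ?A = "\<lambda>n xs. if n = 0 then x else if n = 1 then hd xs else 0"
    let ?K = "\<lambda>n. if n = 0 then norm x else if n = 1 then 1 else 0 :: real"
    show "multilinear_bound n (?A n) (?K n)" for n :: nat
      by (auto simp: multilinear_bound_const multilinear_bound_zero multilinear_bound_hd[simplified])
    show "summable (\<lambda>n. ?K n * 1 ^ n)"
      by (rule summable_finite[of "{0, 1}"]) auto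
    show "(\<lambda>n. ?A n (replicate n h)) sums (x + h)" for h
      using sums_finite[of "{0, 1}" "\<lambda>n. ?A n (replicate n h)"] by simp
  qed auto
  then show ?thesis using power_series_at_linear[OF _ assms] by blast
qed

text \<open>Makes the Weierstrass M-test, stated for \<open>banach\<close>, applicable to values in
  a \<open>complex_banach\<close> space.\<close>

instance complex_banach \<subseteq> banach ..

lemma complex_analytic_onI:
  fixes F :: "'a::complex_banach \<Rightarrow> 'b::complex_banach"
  assumes "open U" "\<And>x. x \<in> U \<Longrightarrow> power_series_at F x"
  shows "complex_analytic_on F U"
  unfolding complex_analytic_on_def
proof (intro conjI ballI)
  fix x assume "x \<in> U"
  then obtain r A K where A: "r > 0" "r \<le> 1" "\<And>n. multilinear_bound n (A n) (K n)" "\<And>n. 0 \<le> K n"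
    "summable (\<lambda>n. K n * r ^ n)" "\<And>h. norm h < r \<Longrightarrow> (\<lambda>n. A n (replicate n h)) sums F (x + h)"
    by (rule power_series_atE[OF assms(2) zero_less_one]) (rule that, assumption+)
  have "norm (A n (replicate n h)) \<le> K n * r ^ n" if "h \<in> ball 0 r" for n h
  proof -
    have "norm (A n (replicate n h)) \<le> K n * norm h ^ n"
      by (rule multilinear_bound_replicate[OF A(3)])
    also have "\<dots> \<le> K n * r ^ n"
      using that A(4) by (intro mult_left_mono power_mono) auto
    finally show ?thesis .
  qed
  from Weierstrass_m_test[OF this A(5)]
  have "uniform_limit (ball 0 r) (\<lambda>N h. \<Sum>n<N. A n (replicate n h)) (\<lambda>h. \<Sum>n. A n (replicate n h)) sequentially" .
  then have "uniform_limit (ball 0 r) (\<lambda>N h. \<Sum>n<N. A n (replicate n h)) (\<lambda>h. F (x + h)) sequentially"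
    by (rule uniform_limit_cong'[THEN iffD1, rotated 2])
       (simp_all add: sums_unique[OF A(6), symmetric])
  then show "\<exists>r>0. \<exists>A. (\<forall>n. bounded_multilinear n (A n)) \<and>
      uniform_limit (ball 0 r) (\<lambda>N h. \<Sum>n<N. A n (replicate n h)) (\<lambda>h. F (x + h)) sequentially"
    using A(1,3) multilinear_bound_bounded by blast
qed (rule assms)

section \<open>The algebra \<open>H\<^sup>1\<close>\<close>

lemma H1_one: "(\<lambda>_. 1) \<in> H1"
  by (rule H1I_translation(1)[where M=1 and B=0]) auto

lemma H1_cis: "(\<lambda>y. cis (2 * pi * of_int j * y)) \<in> H1"
proof -
  have "weighted_l2 (\<lambda>k. if j = k then 1 else 0)"
    unfolding weighted_l2_def
    by (rule summable_on_cong_neutral[where T="{j}", THEN iffD2]) auto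
  then obtain g where g: "g \<in> H1" "fourier_coeff g = (\<lambda>k. if j = k then 1 else 0)"
    by (rule H1_synthesis)
  have "cis (2 * pi * of_int j * (y + 1)) = cis (2 * pi * of_int j * y)" for y
    by (simp add: distrib_left cis_mult[symmetric] cis_multiple_2pi)
  then have "g = (\<lambda>y. cis (2 * pi * of_int j * y))"
    using g by (intro fc_eqI) (auto simp: H1_def fc_cis intro!: continuous_intros)
  with g show ?thesis by simp
qed

typedef h1 = H1 morphisms h1_fun Abs_h1
  using H1_zero by blast

setup_lifting type_definition_h1

lemma h1_fun_H1: "h1_fun u \<in> H1"
  using h1_fun[of u] .

instantiation h1 :: comm_ring_1
begin

lift_definition zero_h1 :: h1 is "\<lambda>_. 0" by (rule H1_zero)
lift_definition one_h1 :: h1 is "\<lambda>_. 1" by (rule H1_one)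
lift_definition plus_h1 :: "h1 \<Rightarrow> h1 \<Rightarrow> h1" is "\<lambda>f g y. f y + g y" by (rule H1_add)
lift_definition uminus_h1 :: "h1 \<Rightarrow> h1" is "\<lambda>f y. - f y"
  using H1_scale[of _ "-1"] by simp
lift_definition minus_h1 :: "h1 \<Rightarrow> h1 \<Rightarrow> h1" is "\<lambda>f g y. f y - g y"
  using H1_add[OF _ H1_scale[of _ "-1"]] by simp
lift_definition times_h1 :: "h1 \<Rightarrow> h1 \<Rightarrow> h1" is "\<lambda>f g y. f y * g y" by (rule H1_mult(1))

instance
  by standard (transfer; simp add: algebra_simps fun_eq_iff)+

end

instantiation h1 :: complex_normed_vector
begin

lift_definition scaleC_h1 :: "complex \<Rightarrow> h1 \<Rightarrow> h1" is "\<lambda>c f y. c * f y" by (rule H1_scale)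
definition "r *\<^sub>R (u :: h1) = complex_of_real r *\<^sub>C u"
lift_definition norm_h1 :: "h1 \<Rightarrow> real" is norm_H1 .
definition "dist (u :: h1) v = norm (u - v)"
definition "sgn (u :: h1) = complex_of_real (inverse (norm u)) *\<^sub>C u"
definition [code del]: "(uniformity :: (h1 \<times> h1) filter) = (INF e\<in>{0<..}. principal {(u, v). dist u v < e})"
definition "open (U :: h1 set) \<longleftrightarrow> (\<forall>u\<in>U. \<forall>\<^sub>F (u', v) in uniformity. u' = u \<longrightarrow> v \<in> U)"

instance
proof
  fix a b :: complex and r s :: real and x y z :: h1 and U :: "h1 set"
  note d = scaleR_h1_def
  show "r *\<^sub>R (x + y) = r *\<^sub>R x + r *\<^sub>R y" unfolding d by transfer (simp add: distrib_left)
  show "(r + s) *\<^sub>R x = r *\<^sub>R x + s *\<^sub>R x" unfolding d by transfer (simp add: distrib_right)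
  show "r *\<^sub>R s *\<^sub>R x = (r * s) *\<^sub>R x" unfolding d by transfer (simp add: mult.assoc)
  show "1 *\<^sub>R x = x" unfolding d by transfer simp
  show "dist x y = norm (x - y)" by (fact dist_h1_def)
  show "sgn x = inverse (norm x) *\<^sub>R x" by (simp only: sgn_h1_def scaleR_h1_def)
  show "(uniformity :: (h1 \<times> h1) filter) = (INF e\<in>{0<..}. principal {(u, v). dist u v < e})"
    by (fact uniformity_h1_def)
  show "open U \<longleftrightarrow> (\<forall>u\<in>U. \<forall>\<^sub>F (u', v) in uniformity. u' = u \<longrightarrow> v \<in> U)"
    by (fact open_h1_def)
  show "norm x = 0 \<longleftrightarrow> x = 0"
  proof transfer
    fix f assume f: "f \<in> H1"
    have "f = (\<lambda>_. 0)" if "norm_H1 f = 0"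
    proof
      fix y show "f y = 0" using norm_le_norm_H1[OF f, of y] that by simp
    qed
    then show "norm_H1 f = 0 \<longleftrightarrow> f = (\<lambda>_. 0)" by (auto simp: norm_H1_def)
  qed
  show "norm (x + y) \<le> norm x + norm y"
    by transfer (simp add: norm_H1_weighted_l2_norm H1_fc_add weighted_l2_add H1_weighted_l2)
  show n: "norm (a *\<^sub>C x) = cmod a * norm x" for a and x :: h1
    by transfer (rule norm_H1_scale)
  show "norm (r *\<^sub>R x) = \<bar>r\<bar> * norm x" by (simp add: scaleR_h1_def n)
  show "a *\<^sub>C (x + y) = a *\<^sub>C x + a *\<^sub>C y" by transfer (simp add: distrib_left)
  show "(a + b) *\<^sub>C x = a *\<^sub>C x + b *\<^sub>C x" by transfer (simp add: distrib_right)
  show "a *\<^sub>C b *\<^sub>C x = (a * b) *\<^sub>C x" by transfer (simp add: mult.assoc)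
  show "complex_of_real r *\<^sub>C x = r *\<^sub>R x" by (simp add: scaleR_h1_def)
qed

end

text \<open>The norm is controlled only up to the factor \<open>mult_const\<close>, so
  multiplication is treated as a bounded bilinear map and not through a normed algebra
  class.\<close>

lemma bounded_cbilinear_h1_mult: "bounded_cbilinear ((*) :: h1 \<Rightarrow> h1 \<Rightarrow> h1)"
proof (rule bounded_cbilinearI)
  fix x y :: h1 and c :: complex
  show "(c *\<^sub>C x) * y = c *\<^sub>C (x * y)" "x * (c *\<^sub>C y) = c *\<^sub>C (x * y)"
    by (transfer; simp add: mult_ac)+
  show "norm (x * y) \<le> norm x * norm y * mult_const"
    by transfer (use H1_mult(2) in \<open>simp add: mult_ac\<close>)
qed (simp_all add: algebra_simps)

definition h1_coeff :: "h1 \<Rightarrow> int \<Rightarrow> complex" where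
  "h1_coeff u = fourier_coeff (h1_fun u)"

lemma h1_eqI: "(\<And>k. h1_coeff u k = h1_coeff v k) \<Longrightarrow> u = v"
  unfolding h1_coeff_def by (metis H1_eqI h1_fun_H1 h1_fun_inject)

lemma h1_coeff_add: "h1_coeff (u + v) k = h1_coeff u k + h1_coeff v k"
  by (simp add: h1_coeff_def plus_h1.rep_eq fc_add H1_cont h1_fun_H1)

lemma h1_coeff_diff: "h1_coeff (u - v) k = h1_coeff u k - h1_coeff v k"
  by (simp add: h1_coeff_def minus_h1.rep_eq fc_diff H1_cont h1_fun_H1)

lemma h1_coeff_scaleC: "h1_coeff (c *\<^sub>C u) k = c * h1_coeff u k"
  by (simp add: h1_coeff_def scaleC_h1.rep_eq fc_scale)

lemma h1_coeff_mult: "((\<lambda>j. h1_coeff u j * h1_coeff v (k - j)) has_sum h1_coeff (u * v) k) UNIV"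
  using has_sum_fc_mult[OF h1_fun_H1 H1_cont[OF h1_fun_H1], of u v k]
  by (simp add: h1_coeff_def times_h1.rep_eq)

lemma norm_h1_weighted_l2: "norm u = weighted_l2_norm (h1_coeff u)"
  by (simp add: h1_coeff_def norm_h1.rep_eq norm_H1_weighted_l2_norm)

lemma h1_coeff_weighted_l2: "weighted_l2 (h1_coeff u)"
  by (simp add: h1_coeff_def H1_weighted_l2 h1_fun_H1)

subsection \<open>Truncations, shifts and reflections\<close>

text \<open>Index maps that do not decrease the weight cover the Fourier truncations, the reflection
  \<open>p \<mapsto> p(- \<cdot>)\<close> and the truncated shifts.\<close>

definition weight_mono :: "int set \<Rightarrow> (int \<Rightarrow> int) \<Rightarrow> bool" where
  "weight_mono S \<sigma> \<longleftrightarrow> inj_on \<sigma> S \<and> (\<forall>k\<in>S. bracket k \<le> bracket (\<sigma> k))"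

lemma weight_mono_id: "weight_mono S (\<lambda>k. k)"
  and weight_mono_uminus: "weight_mono S uminus"
  by (auto simp: weight_mono_def)

lemma weight_mono_shift: "S \<subseteq> {0..} \<Longrightarrow> weight_mono S (\<lambda>k. k + int n)"
  by (auto simp: weight_mono_def inj_on_def bracket_def subset_iff)

text \<open>Injectivity of the index map prevents any coefficient from being counted twice, and its
  weight at the source is at least the weight at the target.\<close>

lemma weighted_l2_reindex:
  assumes "weight_mono S \<sigma>" "weighted_l2 a"
  shows "weighted_l2 (\<lambda>k. if k \<in> S then a (\<sigma> k) else 0)"
    and "weighted_l2_norm (\<lambda>k. if k \<in> S then a (\<sigma> k) else 0) \<le> weighted_l2_norm a"
proof -
  have "L2_set (\<lambda>k. cmod (if k \<in> S then a (\<sigma> k) else 0) * bracket k) F \<le> weighted_l2_norm a"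
    if F: "finite F" for F
  proof -
    have inj: "inj_on \<sigma> (F \<inter> S)" using assms(1) by (auto simp: weight_mono_def intro: inj_on_subset)
    have "(\<Sum>k\<in>F. (cmod (if k \<in> S then a (\<sigma> k) else 0) * bracket k)\<^sup>2)
        = (\<Sum>k\<in>F \<inter> S. (cmod (a (\<sigma> k)) * bracket k)\<^sup>2)"
      using F by (intro sum.mono_neutral_cong_right) auto
    also have "\<dots> \<le> (\<Sum>k\<in>F \<inter> S. (cmod (a (\<sigma> k)) * bracket (\<sigma> k))\<^sup>2)"
    proof (intro sum_mono power_mono mult_left_mono)
      fix k assume "k \<in> F \<inter> S"
      then show "bracket k \<le> bracket (\<sigma> k)" using assms(1) by (simp add: weight_mono_def)
      show "0 \<le> cmod (a (\<sigma> k)) * bracket k" using bracket_ge_1[of k] by simp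
    qed simp
    also have "\<dots> = (\<Sum>k\<in>\<sigma> ` (F \<inter> S). (cmod (a k) * bracket k)\<^sup>2)"
      by (simp add: sum.reindex[OF inj])
    finally have "L2_set (\<lambda>k. cmod (if k \<in> S then a (\<sigma> k) else 0) * bracket k) F
        \<le> L2_set (\<lambda>k. cmod (a k) * bracket k) (\<sigma> ` (F \<inter> S))"
      unfolding L2_set_def by (rule real_sqrt_le_mono)
    also have "\<dots> \<le> weighted_l2_norm a"
      using F by (intro L2_set_le_weighted_l2_norm assms) auto
    finally show ?thesis .
  qed
  note w = weighted_l2I[OF this]
  show "weighted_l2 (\<lambda>k. if k \<in> S then a (\<sigma> k) else 0)" by (rule w(1))
  show "weighted_l2_norm (\<lambda>k. if k \<in> S then a (\<sigma> k) else 0) \<le> weighted_l2_norm a" by (rule w(2))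
qed

text \<open>For a \<open>weight_mono\<close> index map the chosen element exists by synthesis from
  its coefficients, and \<open>h1_eqI\<close> makes it the only one.\<close>

definition reindex :: "int set \<Rightarrow> (int \<Rightarrow> int) \<Rightarrow> h1 \<Rightarrow> h1" where
  "reindex S \<sigma> u = (SOME v. h1_coeff v = (\<lambda>k. if k \<in> S then h1_coeff u (\<sigma> k) else 0))"

lemma h1_coeff_reindex:
  assumes "weight_mono S \<sigma>"
  shows "h1_coeff (reindex S \<sigma> u) = (\<lambda>k. if k \<in> S then h1_coeff u (\<sigma> k) else 0)"
  unfolding reindex_def
proof (rule someI_ex)
  obtain g where "g \<in> H1" "fourier_coeff g = (\<lambda>k. if k \<in> S then h1_coeff u (\<sigma> k) else 0)"
    using H1_synthesis[OF weighted_l2_reindex(1)[OF assms h1_coeff_weighted_l2]] by blast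
  then show "\<exists>v. h1_coeff v = (\<lambda>k. if k \<in> S then h1_coeff u (\<sigma> k) else 0)"
    by (intro exI[of _ "Abs_h1 g"]) (simp add: h1_coeff_def Abs_h1_inverse)
qed

lemma bounded_clinear_reindex:
  assumes "weight_mono S \<sigma>"
  shows "bounded_clinear (reindex S \<sigma>)"
proof (rule bounded_clinearI[where K=1])
  show "norm (reindex S \<sigma> u) \<le> norm u * 1" for u
    using weighted_l2_reindex(2)[OF assms h1_coeff_weighted_l2]
    by (simp add: norm_h1_weighted_l2 h1_coeff_reindex[OF assms])
qed (rule h1_eqI; simp add: h1_coeff_reindex[OF assms] h1_coeff_add h1_coeff_scaleC)+

text \<open>The bridge from the pointwise sums in \<open>Pi_plus\<close> and \<open>Pi_plus0\<close>
  to bounded linear maps on \<open>h1\<close>.\<close>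

lemma h1_fun_truncation:
  "h1_fun (reindex S (\<lambda>k. k) u) y = (\<Sum>\<^sub>\<infinity>k\<in>S. h1_coeff u k * cis (2 * pi * of_int k * y))"
proof -
  have "h1_fun (reindex S (\<lambda>k. k) u) y
      = (\<Sum>\<^sub>\<infinity>k. h1_coeff (reindex S (\<lambda>k. k) u) k * cis (2 * pi * of_int k * y))"
    unfolding h1_coeff_def by (rule infsumI[OF H1_fourier_series[OF h1_fun_H1], symmetric])
  also have "\<dots> = (\<Sum>\<^sub>\<infinity>k\<in>S. h1_coeff u k * cis (2 * pi * of_int k * y))"
    by (intro infsum_cong_neutral) (auto simp: h1_coeff_reindex weight_mono_id)
  finally show ?thesis .
qed

lemma Pi_plus_eq: "Pi_plus (h1_fun u) = h1_fun (reindex {0..} (\<lambda>k. k) u)"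
  by (rule ext) (simp add: Pi_plus_def h1_fun_truncation h1_coeff_def)

lemma Pi_plus0_eq: "Pi_plus0 (h1_fun u) = h1_fun (reindex {1..} (\<lambda>k. k) u)"
  by (rule ext) (simp add: Pi_plus0_def h1_fun_truncation h1_coeff_def)

lemma h1_fun_reflect: "h1_fun (reindex UNIV uminus u) y = h1_fun u (- y)"
proof -
  have "((\<lambda>k. h1_coeff u (- k) * cis (2 * pi * of_int k * y)) has_sum h1_fun (reindex UNIV uminus u) y) UNIV"
    using H1_fourier_series[OF h1_fun_H1, of "reindex UNIV uminus u" y]
    by (simp add: h1_coeff_reindex[unfolded h1_coeff_def] weight_mono_uminus h1_coeff_def)
  moreover have "((\<lambda>k. h1_coeff u (- k) * cis (2 * pi * of_int k * y)) has_sum h1_fun u (- y)) UNIV"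
    using H1_fourier_series[OF h1_fun_H1, of u "- y"]
      has_sum_reindex_bij_betw[OF bij_uminus, of "\<lambda>k. fourier_coeff (h1_fun u) k * cis (2 * pi * of_int k * (- y))"]
    by (simp add: h1_coeff_def)
  ultimately show ?thesis by (rule has_sum_unique)
qed

lemma pairing_eq: "pairing (h1_fun u) (h1_fun p) = h1_coeff (u * reindex UNIV uminus p) 0"
proof -
  have "((\<lambda>j. h1_coeff u j * h1_coeff p j) has_sum h1_coeff (u * reindex UNIV uminus p) 0) UNIV"
    using h1_coeff_mult[of u "reindex UNIV uminus p" 0]
    by (simp add: h1_coeff_reindex weight_mono_uminus)
  then show ?thesis by (simp add: pairing_def h1_coeff_def infsumI)
qed

text \<open>An untruncated shift lowers weights at negative indices and so is not
  \<open>weight_mono\<close>. It is instead multiplication by a character, which stays in the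
  algebra.\<close>

definition cis_h1 :: "int \<Rightarrow> h1" where
  "cis_h1 j = Abs_h1 (\<lambda>y. cis (2 * pi * of_int j * y))"

lemma h1_fun_cis: "h1_fun (cis_h1 j) y = cis (2 * pi * of_int j * y)"
  by (simp only: cis_h1_def Abs_h1_inverse[OF H1_cis])

lemma shift_pow_eq: "(shift ^^ n) (h1_fun u) = h1_fun (cis_h1 (- 1) ^ n * u)"
proof (induction n)
  case (Suc n)
  have "(shift ^^ Suc n) (h1_fun u) = shift (h1_fun (cis_h1 (- 1) ^ n * u))"
    using Suc.IH by simp
  also have "\<dots> = h1_fun (cis_h1 (- 1) * (cis_h1 (- 1) ^ n * u))"
    by (rule ext) (simp add: shift_def times_h1.rep_eq h1_fun_cis mult.commute)
  finally show ?case by (simp add: mult.assoc)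
qed (simp add: one_h1.rep_eq)

lemma h1_coeff_cis_mult: "h1_coeff (cis_h1 j * u) k = h1_coeff u (k - j)"
  using fc_cis_mult[of "h1_fun u" j k]
  by (simp add: h1_coeff_def times_h1.rep_eq h1_fun_cis mult.commute)

lemma h1_coeff_cis_pow_mult: "h1_coeff (cis_h1 (- 1) ^ n * u) k = h1_coeff u (k + int n)"
  by (induction n arbitrary: k) (simp_all add: h1_coeff_cis_mult mult.assoc add_ac)

lemma Pi_plus_shift_eq: "Pi_plus ((shift ^^ n) (h1_fun u)) = h1_fun (reindex {0..} (\<lambda>k. k + int n) u)"
  unfolding shift_pow_eq Pi_plus_eq
  by (intro arg_cong[of _ _ h1_fun] h1_eqI)
     (simp add: h1_coeff_reindex weight_mono_id weight_mono_shift h1_coeff_cis_pow_mult)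

text \<open>Both sides are \<open>\<Sum>\<^sub>j\<^sub>\<ge>\<^sub>0 u\<^sub>j\<^sub>+\<^sub>n v\<^sub>-\<^sub>j\<close>: in the pairing with \<open>p\<close>, the \<open>n\<close>-fold shift turns
  into an evaluation of the \<open>n\<close>-th coefficient.\<close>

lemma h1_coeff_shift_mult:
  "h1_coeff (reindex {0..} (\<lambda>k. k + int n) u * v) 0 = h1_coeff (u * reindex {..0} (\<lambda>k. k) v) (int n)"
proof -
  let ?t = "\<lambda>m. h1_coeff u m * (if m \<ge> int n then h1_coeff v (int n - m) else 0)"
  have "(?t has_sum h1_coeff (u * reindex {..0} (\<lambda>k. k) v) (int n)) UNIV"
    using h1_coeff_mult[of u "reindex {..0} (\<lambda>k. k) v" "int n"]
    by (simp add: h1_coeff_reindex weight_mono_id)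
  moreover have "(?t has_sum h1_coeff (reindex {0..} (\<lambda>k. k + int n) u * v) 0) UNIV"
  proof -
    have bij: "bij_betw (\<lambda>j. j + int n) UNIV UNIV"
      by (rule bij_betw_byWitness[where f'="\<lambda>m. m - int n"]) auto
    have "((\<lambda>j. ?t (j + int n)) has_sum h1_coeff (reindex {0..} (\<lambda>k. k + int n) u * v) 0) UNIV"
      using h1_coeff_mult[of "reindex {0..} (\<lambda>k. k + int n) u" v 0]
      by (simp add: h1_coeff_reindex weight_mono_shift if_distrib[of "\<lambda>x. _ * x"] if_distrib[of "\<lambda>x. x * _"] cong: if_cong)
    then show ?thesis
      using has_sum_reindex_bij_betw[OF bij, of ?t] by simp
  qed
  ultimately show ?thesis by (rule has_sum_unique[symmetric])
qed

section \<open>Analyticity of the momentum map\<close>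

lift_definition emb :: "h1_plus0 \<Rightarrow> h1" is "\<lambda>f. f" by simp

lemma bounded_clinear_emb: "bounded_clinear emb"
  by (rule bounded_clinearI[where K=1]) (transfer; simp)+

text \<open>The index shift by one reflects that the \<open>k\<close>-th momentum is a coefficient
  of index \<open>k + 1\<close>. The coefficient of index 1 is discarded together with those of
  nonpositive index.\<close>

definition shift_trunc :: "h1 \<Rightarrow> h1_plus0" where
  "shift_trunc u = Abs_h1_plus0 (h1_fun (reindex {1..} (\<lambda>k. k + 1) u))"

lemma weight_mono_Suc: "weight_mono {1..} (\<lambda>k. k + 1)"
  using weight_mono_shift[of "{1..}" 1] by auto

lemma emb_shift_trunc: "emb (shift_trunc u) = reindex {1..} (\<lambda>k. k + 1) u"
proof -
  have "fun_of (shift_trunc u) = h1_fun (reindex {1..} (\<lambda>k. k + 1) u)"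
    unfolding shift_trunc_def
    by (rule Abs_h1_plus0_inverse)
       (simp add: h1_fun_H1 h1_coeff_reindex[OF weight_mono_Suc, unfolded h1_coeff_def])
  then show ?thesis by (metis emb.rep_eq h1_fun_inverse)
qed

lemma emb_inject: "emb u = emb v \<Longrightarrow> u = v"
  by transfer

text \<open>Since \<open>emb\<close> is linear, injective and isometric, everything can be checked
  after embedding, where the map is a \<open>reindex\<close>.\<close>

lemma bounded_clinear_shift_trunc: "bounded_clinear shift_trunc"
proof (rule bounded_clinearI)
  have norm_emb: "norm (emb v) = norm v" for v
    by transfer simp
  note l = bounded_clinear_reindex[OF weight_mono_Suc]
  interpret R: bounded_linear "reindex {1..} (\<lambda>k. k + 1)"
    using l by (simp add: bounded_clinear_def)
  interpret E: bounded_linear emb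
    using bounded_clinear_emb by (simp add: bounded_clinear_def)
  show "shift_trunc (u + v) = shift_trunc u + shift_trunc v" for u v
    by (rule emb_inject) (simp add: emb_shift_trunc E.add R.add)
  show "shift_trunc (c *\<^sub>C u) = c *\<^sub>C shift_trunc u" for c u
    by (rule emb_inject)
       (use l bounded_clinear_emb in \<open>simp add: bounded_clinear_def emb_shift_trunc\<close>)
  show "norm (shift_trunc u) \<le> norm u * onorm (reindex {1..} (\<lambda>k. k + 1))" for u
    using onorm[OF R.bounded_linear_axioms, of u]
    by (simp add: norm_emb[of "shift_trunc u", symmetric] emb_shift_trunc mult.commute)
qed

text \<open>Meaningful only where \<open>u\<close> has no zero; otherwise the pointwise inverse may
  leave \<open>H1\<close>, where \<open>Abs_h1\<close> is unspecified.\<close>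

definition h1_inverse :: "h1 \<Rightarrow> h1" where
  "h1_inverse u = Abs_h1 (\<lambda>y. inverse (h1_fun u y))"

lemma h1_fun_inverse_eq: "(\<And>y. h1_fun u y \<noteq> 0) \<Longrightarrow> h1_fun (h1_inverse u) y = inverse (h1_fun u y)"
  unfolding h1_inverse_def by (subst Abs_h1_inverse) (auto intro: H1_inverse h1_fun_H1)

lemma h1_inverse_mult: "(\<And>y. h1_fun u y \<noteq> 0) \<Longrightarrow> h1_inverse u * u = 1"
  by (rule h1_fun_inject[THEN iffD1], rule ext)
     (simp add: times_h1.rep_eq one_h1.rep_eq h1_fun_inverse_eq)

lemma open_nonvanishing: "open nonvanishing"
  unfolding open_contains_ball
proof
  fix w assume "w \<in> nonvanishing"
  then obtain m where m: "m > 0" "\<And>y. m \<le> cmod (fun_of w y)"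
    using H1_nonvanishing_lower_bound[OF fun_of_H1] by (auto simp: nonvanishing_def)
  \<comment> \<open>The radius keeps the uniform distance below the minimum modulus
    \<open>m\<close>. Adding 1 guarantees a positive denominator, as \<open>sup_const\<close> is
    only known to be nonnegative.\<close>
  have "v \<in> nonvanishing" if "v \<in> ball w (m / (sup_const + 1))" for v
  proof -
    have "norm (w - v) * (sup_const + 1) < m"
      using that sup_const_nonneg by (simp add: dist_norm pos_less_divide_eq)
    then have "sup_const * norm (w - v) < m"
      using norm_ge_zero[of "w - v"] by (simp add: algebra_simps del: norm_ge_zero)
    moreover have "cmod (fun_of w y - fun_of v y) \<le> sup_const * norm (w - v)" for y
      using norm_le_norm_H1[OF fun_of_H1[of "w - v"], of y]
      by (simp add: norm_h1_plus0.rep_eq minus_h1_plus0_def uminus_h1_plus0_def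
          plus_h1_plus0.rep_eq scaleC_h1_plus0.rep_eq)
    ultimately have "cmod (fun_of w y - fun_of v y) < cmod (fun_of w y)" for y
      using m(2)[of y] by (metis less_le_trans order_le_less_trans)
    then show ?thesis
      unfolding nonvanishing_def by (auto dest: spec) (metis diff_zero less_irrefl)
  qed
  then show "\<exists>e>0. ball w e \<subseteq> nonvanishing"
    using m(1) sup_const_nonneg by (intro exI[of _ "m / (sup_const + 1)"]) auto
qed

definition momentum :: "h1 \<Rightarrow> h1_plus0 \<times> h1_plus0 \<Rightarrow> h1_plus0" where
  "momentum u z = (let w = emb (fst z); p = reindex UNIV uminus (emb (snd z));
       g = reindex {1..} (\<lambda>k. k) (w * p)
     in shift_trunc (w * reindex {..0} (\<lambda>k. k) (g * p) - g * reindex {..0} (\<lambda>k. k) (w * p)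
          - w * reindex {1..} (\<lambda>k. k) (u * h1_inverse w)))"

lemma J_coeff_eq:
  assumes w: "w \<in> nonvanishing" and k: "k \<ge> 1"
  shows "J_coeff (h1_fun u) k (fun_of w) (fun_of p) = h1_coeff (emb (momentum u (w, p))) (int k)"
proof -
  let ?w = "emb w" and ?p = "reindex UNIV uminus (emb p)" and ?n = "k + 1"
  let ?g = "reindex {1..} (\<lambda>k. k) (?w * ?p)"
  let ?N = "reindex {..0} (\<lambda>k. k)" and ?S = "reindex {0..} (\<lambda>k. k + int ?n)"
  have nz: "h1_fun ?w y \<noteq> 0" for y
    using w by (simp add: nonvanishing_def emb.rep_eq)
  have "Gamma_op (fun_of w) (fun_of p) = Pi_plus0 (h1_fun (?w * ?p))"
    by (simp add: Gamma_op_def times_h1.rep_eq h1_fun_reflect emb.rep_eq)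
  then have G: "Gamma_op (fun_of w) (fun_of p) = h1_fun ?g"
    by (simp add: Pi_plus0_eq)
  have "A_op k (fun_of w) (h1_fun ?g) = h1_fun (?g * ?S ?w - ?w * ?S ?g)"
    by (rule ext) (simp only: A_op_def Pi_plus_shift_eq minus_h1.rep_eq times_h1.rep_eq emb.rep_eq[symmetric])
  then have "I_coeff k (fun_of w) (fun_of p) = h1_coeff ((?g * ?S ?w - ?w * ?S ?g) * ?p) 0"
    unfolding I_coeff_def G unfolding emb.rep_eq[symmetric] by (simp only: pairing_eq)
  \<comment> \<open>Regrouped so that each product has the truncated shift as a separate factor;
    \<open>h1_coeff_shift_mult\<close> then applies with \<open>?g * ?p\<close> and
    \<open>?w * ?p\<close> as the other factor.\<close>
  also have "(?g * ?S ?w - ?w * ?S ?g) * ?p = ?S ?w * (?g * ?p) - ?S ?g * (?w * ?p)"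
    by (simp add: algebra_simps)
  also have "h1_coeff \<dots> 0 = h1_coeff (?w * ?N (?g * ?p)) (int ?n) - h1_coeff (?g * ?N (?w * ?p)) (int ?n)"
    by (simp only: h1_coeff_diff h1_coeff_shift_mult)
  finally have I: "I_coeff k (fun_of w) (fun_of p)
      = h1_coeff (?w * ?N (?g * ?p)) (int ?n) - h1_coeff (?g * ?N (?w * ?p)) (int ?n)" .
  have "(\<lambda>x. h1_fun u x / fun_of w x) = h1_fun (u * h1_inverse ?w)"
    by (rule ext) (simp add: times_h1.rep_eq h1_fun_inverse_eq[OF nz] divide_inverse emb.rep_eq)
  then have "Pi_plus0 (\<lambda>x. h1_fun u x / fun_of w x)
      = h1_fun (reindex {1..} (\<lambda>k. k) (u * h1_inverse ?w))"
    by (simp only: Pi_plus0_eq)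
  then have U: "U_coeff (h1_fun u) k (fun_of w)
      = - h1_coeff (?w * reindex {1..} (\<lambda>k. k) (u * h1_inverse ?w)) (int ?n)"
    by (simp add: U_coeff_def h1_coeff_def times_h1.rep_eq emb.rep_eq)
  show ?thesis
    using k by (simp add: J_coeff_def I U momentum_def Let_def emb_shift_trunc
        h1_coeff_reindex[OF weight_mono_Suc] h1_coeff_diff add.commute)
qed

text \<open>The coefficients of positive index are prescribed and the others vanish by the type. The
  equivalence yields existence, uniqueness and the value of the description in
  \<open>momentum_map\<close> together.\<close>

lemma momentum_unique:
  assumes w: "w \<in> nonvanishing"
  shows "(\<forall>k::nat. k \<ge> 1 \<longrightarrow> fourier_coeff (fun_of g) (int k) = J_coeff (h1_fun u) k (fun_of w) (fun_of p))
      \<longleftrightarrow> g = momentum u (w, p)" (is "?L \<longleftrightarrow> _")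
proof
  assume ?L
  then have L: "h1_coeff (emb g) (int k) = h1_coeff (emb (momentum u (w, p))) (int k)" if "k \<ge> 1" for k
    unfolding J_coeff_eq[OF w that, symmetric] using \<open>?L\<close> that by (simp add: h1_coeff_def emb.rep_eq)
  have "h1_coeff (emb g) k = h1_coeff (emb (momentum u (w, p))) k" for k
    using L[of "nat k"] by (cases "k \<ge> 1") (auto simp: h1_coeff_def emb.rep_eq fc_fun_of_nonpos)
  then show "g = momentum u (w, p)" by (intro emb_inject h1_eqI)
qed (auto simp: J_coeff_eq[OF w] h1_coeff_def emb.rep_eq)

text \<open>With \<open>v\<close> and \<open>V\<close> the inverses at \<open>x\<close> and
  \<open>x + h\<close>, inserting \<open>v * L x = 1\<close> and \<open>V * L (x + h) = 1\<close>
  gives the resolvent identity \<open>V = v - v * L h * V\<close>, a fixed point equation linear in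
  \<open>h\<close>. Building the linear map \<open>L\<close> into the statement avoids composing
  power series.\<close>

lemma power_series_at_inverse:
  fixes x :: "'a::complex_normed_vector"
  assumes L: "bounded_clinear L" and U: "open U" "x \<in> U" and nz: "\<And>z y. z \<in> U \<Longrightarrow> h1_fun (L z) y \<noteq> 0"
  shows "power_series_at (\<lambda>z. h1_inverse (L z)) x"
proof -
  interpret L: bounded_linear L using L by (simp add: bounded_clinear_def)
  let ?v = "h1_inverse (L x)"
  obtain e where e: "e > 0" "ball x e \<subseteq> U"
    using U open_contains_ball by blast
  show ?thesis
  proof (rule power_series_at_fixed_point[OF _ e(1)])
    have "bounded_clinear ((*) ?v)"
      using bounded_cbilinear_h1_mult unfolding bounded_cbilinear_def bounded_clinear_def
      by (auto intro: bounded_bilinear.bounded_linear_right)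
    then show "bounded_cbilinear (\<lambda>h u. - (?v * L h) * u)"
      by (intro bounded_cbilinear_compose[OF bounded_cbilinear_h1_mult]
          bounded_clinear_compose[OF bounded_clinear_uminus] bounded_clinear_compose[OF _ L])
    fix h :: 'a assume h: "norm h < e"
    let ?V = "h1_inverse (L (x + h))"
    have "?v * L x = 1" "?V * L (x + h) = 1"
      using h e U by (auto intro!: h1_inverse_mult nz simp: dist_norm)
    then have "?V = ?v * (L x * ?V)" "?v = ?v * (L (x + h) * ?V)"
      by (simp_all add: mult.assoc[symmetric] mult.commute[of "L (x + h)"])
    then show "?V = ?v + - (?v * L h) * ?V"
      by (simp add: L.add algebra_simps)
  qed
qed

lemma power_series_at_h1_mult:
  "power_series_at F x \<Longrightarrow> power_series_at G x \<Longrightarrow> power_series_at (\<lambda>z. F z * G z :: h1) x"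
  by (rule power_series_at_bilinear[OF _ _ bounded_cbilinear_h1_mult])

lemma power_series_at_diff:
  "power_series_at F x \<Longrightarrow> power_series_at G x \<Longrightarrow> power_series_at (\<lambda>z. F z - G z) x"
  using power_series_at_add[OF _ power_series_at_linear[OF _ bounded_clinear_uminus], of F x G] by simp

lemma power_series_at_momentum:
  assumes "fst x \<in> nonvanishing"
  shows "power_series_at (momentum u) x"
proof -
  have W: "bounded_clinear (\<lambda>z. emb (fst z))"
    by (rule bounded_clinear_compose[OF bounded_clinear_emb bounded_clinear_fst])
  have P: "bounded_clinear (\<lambda>z. reindex UNIV uminus (emb (snd z)))"
    by (intro bounded_clinear_compose[OF bounded_clinear_reindex[OF weight_mono_uminus]]
        bounded_clinear_compose[OF bounded_clinear_emb] bounded_clinear_snd)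
  have V: "power_series_at (\<lambda>z. h1_inverse (emb (fst z))) x"
  proof (rule power_series_at_inverse[OF W])
    show "open (nonvanishing \<times> (UNIV :: h1_plus0 set))"
      by (intro open_Times open_nonvanishing open_UNIV)
    show "x \<in> nonvanishing \<times> UNIV" using assms by (simp add: mem_Times_iff)
    show "h1_fun (emb (fst z)) y \<noteq> 0" if "z \<in> nonvanishing \<times> UNIV" for z y
      using that by (auto simp: nonvanishing_def emb.rep_eq)
  qed
  note trunc = power_series_at_linear[OF _ bounded_clinear_reindex[OF weight_mono_id]]
  show ?thesis
    unfolding momentum_def Let_def
    by (intro power_series_at_linear[OF _ bounded_clinear_shift_trunc] power_series_at_diff
        power_series_at_h1_mult trunc power_series_at_bounded_clinear[OF W]
        power_series_at_bounded_clinear[OF P] power_series_at_const V)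
qed

theorem proposition1p1:
  fixes f :: "real \<Rightarrow> complex"
  assumes "f \<in> H1"
  shows "(\<forall>w\<in>nonvanishing. \<forall>p. \<exists>!g. \<forall>k::nat. k \<ge> 1 \<longrightarrow>
            fourier_coeff (fun_of g) (int k) = J_coeff f k (fun_of w) (fun_of p)) \<and>
         complex_analytic_on (momentum_map f) (nonvanishing \<times> UNIV)"
proof -
  obtain u where f: "f = h1_fun u" using assms Abs_h1_inverse by metis
  \<comment> \<open>The description in \<open>momentum_map\<close> is resolved only over
    \<open>nonvanishing\<close>; openness of this set is what lets analyticity pass across the
    equation.\<close>
  have eq: "momentum_map f z = momentum u z" if "z \<in> nonvanishing \<times> UNIV" for z
    using that by (auto simp: momentum_map_def f momentum_unique simp del: One_nat_def)
  have op: "open (nonvanishing \<times> (UNIV :: h1_plus0 set))"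
    by (intro open_Times open_nonvanishing open_UNIV)
  have "complex_analytic_on (momentum_map f) (nonvanishing \<times> UNIV)"
  proof (rule complex_analytic_onI[OF op])
    fix x :: "h1_plus0 \<times> h1_plus0" assume "x \<in> nonvanishing \<times> UNIV"
    then show "power_series_at (momentum_map f) x"
      using eq by (intro power_series_at_cong[OF power_series_at_momentum op]) auto
  qed
  then show ?thesis by (simp add: f momentum_unique del: One_nat_def)
qed

end
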